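(* Consider the multi-cone SOCO pair with feasible sets $\mathcal F_P,\mathcal F_D$, and the SDO pair $(\mathcal P)$, $(\mathcal D)$ of the context with feasible sets $\mathcal F_P^{SDO}$ (of $\tilde X$) and $\mathcal F_D^{SDO}$ (of $(\tilde y,v,z,\tilde S)$). Let $u_i=1+\sum_{k=0}^{i-1}n_k$ with $n_0=0$. Define the mapping $\mathcal M$ sending $(\bar x,\bar y,\bar s)=(\bar x^1;\dots;\bar x^r;\bar y;\bar s^1;\dots;\bar s^r)\in\mathcal F_P\times\mathcal F_D$ to all $(\tilde X,\tilde y,v,z,\tilde S)$ with $$\tilde X=\mathrm{DArw}(\bar x^1,\dots,\bar x^r),\qquad\tilde y=\bar y,$$ $\tilde S$ block diagonal with symmetric diagonal blocks $S^1,\dots,S^r$ ($S^i$ of size $n_i\times n_i$), $\tilde S\succeq0$, and $$\sum_{j=u_i}^{u_i+n_i-1}\tilde S_{jj}=\bar s^i_1,\qquad\tilde S_{u_i,u_i+j-1}=\frac{\bar s^i_j}2\ (j=2,\dots,n_i),\qquad i=1,\dots,r,$$ with $v$ and $z$ the corresponding values for which the dual equality constraint of $(\mathcal D)$ holds with this $\tilde S\succeq0$. Define the inverse mapping $\mathcal M^{-1}$ sending $(\tilde X,\tilde y,v,z,\tilde S)\in\mathcal F_P^{SDO}\times\mathcal F_D^{SDO}$ to $(\bar x,\bar y,\bar s)$ with $\bar y=\tilde y$ and, for $i=1,\dots,r$, $$\bar x^i=(\tilde X_{u_i,u_i},\tilde X_{u_i+1,u_i},\dots,\tilde X_{u_i+n_i-1,u_i})^T,\qquad\bar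 s^i=\Big(\sum_{j=u_i}^{u_i+n_i-1}\tilde S_{jj},\,2\tilde S_{u_i,u_i+1},\dots,2\tilde S_{u_i,u_i+n_i-1}\Big)^T.$$ Then $\mathcal M$, with inverse mapping $\mathcal M^{-1}$, is an admissible mapping.
   Context: Data: $r\ge1$, dimensions $n_1,\dots,n_r$, $\bar n=\sum_in_i$, $A^i\in\mathbb R^{m\times n_i}$ with entries $a^i_{jl}$, $c^i\in\mathbb R^{n_i}$, $b\in\mathbb R^m$. $\mathcal L^k=\{x\in\mathbb R^k:x_1\ge\|x_{2:k}\|_2\}$, $x_{2:k}=(x_2,\dots,x_k)$. $\mathrm{Arw}(x)=\begin{pmatrix}x_1&x_{2:k}^T\\ x_{2:k}&x_1I_{k-1}\end{pmatrix}$ for $x\in\mathbb R^k$; $\mathrm{DArw}(x^1,\dots,x^r)$ is block diagonal with blocks $\mathrm{Arw}(x^1),\dots,\mathrm{Arw}(x^r)$. SOCO pair: $\min\{\sum_i(c^i)^T\bar x^i:\sum_iA^i\bar x^i=b,\ \bar x^i\in\mathcal L^{n_i}\ \forall i\}$ and $\max\{b^T\bar y:(A^i)^T\bar y+\bar s^i=c^i,\ \bar s^i\in\mathcal L^{n_i}\ \forall i\}$. SDO data ($\bar n\times\bar n$ matrices): $\tilde{\mathtt C}$ is block diagonal with blocks $\mathrm{Arw}(\frac1{n_i}c^i_1,\frac12c^i_2,\dots,\frac12c^i_{n_i})$, $i=1,\dots,r$; $\tilde{\mathtt A}_j$ ($j=1,\dots,m$) is block diagonal with blocks $\mathrm{Arw}(\frac1{n_i}a^i_{j1},\frac12a^i_{j2},\dots,\frac12a^i_{jn_i})$,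 $i=1,\dots,r$. For a row index $h\in\{1,\dots,\bar n\}$ let $\mathrm{Cf}(h)$ be the index of the block containing row $h$. $\mathcal I$ is the set of pairs $(h,l)$ with $1\le h<l\le\bar n$ such that either $l>\sum_{t=0}^{\mathrm{Cf}(h)}n_t$ (off-block-diagonal), or $\sum_{t=0}^{\mathrm{Cf}(h)-1}n_t+1<h<l\le\sum_{t=0}^{\mathrm{Cf}(h)}n_t$ (off-arrow inside a block). $\mathcal K$ is the set of $k$ with $\sum_{t=0}^{\mathrm{Cf}(k)-1}n_t+1<k\le\sum_{t=0}^{\mathrm{Cf}(k)}n_t$. For $(h,l)\in\mathcal I$, $\tilde{\check{\mathtt A}}_{hl}$ is the symmetric matrix with entries $1$ at $(h,l)$ and $(l,h)$ and zeros elsewhere; for $k\in\mathcal K$, $\tilde{\hat{\mathtt A}}_k$ has entry $-1$ at $(k,k)$, entry $1$ at $(p,p)$ with $p=\sum_{t=0}^{\mathrm{Cf}(k)-1}n_t+1$, and zeros elsewhere. $(\mathcal P)$: $\min\mathrm{Tr}(\tilde{\mathtt C}\tilde X)$ s.t. $\mathrm{Tr}(\tilde{\mathtt A}_j\tilde X)=b_j$ ($j=1,\dots,m$), $\mathrm{Tr}(\tilde{\check{\mathtt A}}_{hl}\tilde X)=0$ ($(h,l)\in\mathcal I$), $\mathrm{Tr}(\tilde{\hat{\mathtt A}}_k\tilde X)=0$ ($k\in\mathcal K$), $\tilde X\succeq0$. $(\mathcal D)$: $\max b^T\tilde y$ s.t. $\sum_{j=1}^m\tilde y_j\tilde{\mathtt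 A}_j+\sum_{(h,l)\in\mathcal I}v_{hl}\tilde{\check{\mathtt A}}_{hl}+\sum_{k\in\mathcal K}z_k\tilde{\hat{\mathtt A}}_k+\tilde S=\tilde{\mathtt C}$, $\tilde S\succeq0$. Admissible: $\mathcal M$ with inverse mapping $\mathcal M^{-1}$ is admissible if points of $\mathcal F_P\times\mathcal F_D$ are mapped by $\mathcal M$ into $\mathcal F_P^{SDO}\times\mathcal F_D^{SDO}$ (for a point-to-set map: every element of the image is feasible); points of $\mathcal F_P^{SDO}\times\mathcal F_D^{SDO}$ are mapped by $\mathcal M^{-1}$ into $\mathcal F_P\times\mathcal F_D$; and $\sum_i(c^i)^T\bar x^i=\mathrm{Tr}(\tilde{\mathtt C}\tilde X)$, $b^T\bar y=b^T\tilde y$ for corresponding points. *)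

theory Defs
  imports "HOL-Analysis.L2_Norm" "HOL-Library.FuncSet" "Jordan_Normal_Form.Matrix"
begin

text \<open>
  Everything is indexed from 0, as in the matrix library: the dimensions
  \<open>n\<^sub>1, \<dots>, n\<^sub>r\<close> are the entries of a list \<open>ns\<close>, the data \<open>A\<^sup>i\<close>, \<open>c\<^sup>i\<close> and the variables
  \<open>x\<^sup>i\<close>, \<open>s\<^sup>i\<close> are entries of lists of the same length, and the first component of a
  vector is \<open>x $ 0\<close>.
\<close>

definition lorentz_cone :: "nat \<Rightarrow> real vec set" where
  "lorentz_cone k = {x \<in> carrier_vec k. x $ 0 \<ge> L2_set (\<lambda>j. x $ j) {1..<k}}"

definition Arw :: "real vec \<Rightarrow> real mat" where
  "Arw x = mat (dim_vec x) (dim_vec x)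
     (\<lambda>(p, q). if p = q then x $ 0 else if p = 0 then x $ q else if q = 0 then x $ p else 0)"

definition DArw :: "real vec list \<Rightarrow> real mat" where
  "DArw xs = diag_block_mat (map Arw xs)"

definition trace_mat :: "real mat \<Rightarrow> real" where
  "trace_mat A = (\<Sum>i<dim_row A. A $$ (i, i))"

definition sym_mat :: "nat \<Rightarrow> real mat \<Rightarrow> bool" where
  "sym_mat k A \<longleftrightarrow> A \<in> carrier_mat k k \<and> transpose_mat A = A"

definition psd_mat :: "nat \<Rightarrow> real mat \<Rightarrow> bool" where
  "psd_mat k A \<longleftrightarrow> sym_mat k A \<and> (\<forall>w \<in> carrier_vec k. w \<bullet> (A *\<^sub>v w) \<ge> 0)"

definition lincomb_mat :: "nat \<Rightarrow> ('i \<Rightarrow> real) \<Rightarrow> ('i \<Rightarrow> real mat) \<Rightarrow> 'i set \<Rightarrow> real mat" where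
  "lincomb_mat k a F I = mat k k (\<lambda>(p, q). \<Sum>i\<in>I. a i * F i $$ (p, q))"


subsection \<open>The SOCO pair\<close>

definition soco_primal_feasible ::
    "nat list \<Rightarrow> nat \<Rightarrow> real mat list \<Rightarrow> real vec \<Rightarrow> real vec list set" where
  "soco_primal_feasible ns m A b =
     {x. length x = length ns
         \<and> finsum_vec TYPE(real) m (\<lambda>i. A ! i *\<^sub>v x ! i) {..<length ns} = b
         \<and> (\<forall>i<length ns. x ! i \<in> lorentz_cone (ns ! i))}"

definition soco_dual_feasible ::
    "nat list \<Rightarrow> nat \<Rightarrow> real mat list \<Rightarrow> real vec list \<Rightarrow> (real vec \<times> real vec list) set" where
  "soco_dual_feasible ns m A c =
     {(y, s). y \<in> carrier_vec m \<and> length s = length ns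
         \<and> (\<forall>i<length ns. transpose_mat (A ! i) *\<^sub>v y + s ! i = c ! i)
         \<and> (\<forall>i<length ns. s ! i \<in> lorentz_cone (ns ! i))}"

definition soco_primal_obj :: "real vec list \<Rightarrow> real vec list \<Rightarrow> real" where
  "soco_primal_obj c x = (\<Sum>i<length c. c ! i \<bullet> x ! i)"


subsection \<open>The SDO pair\<close>

definition sdo_data_mat :: "real vec list \<Rightarrow> real mat" where
  "sdo_data_mat cs =
     DArw (map (\<lambda>c. vec (dim_vec c)
                  (\<lambda>l. if l = 0 then c $ 0 / real (dim_vec c) else c $ l / 2)) cs)"

definition sdo_C :: "real vec list \<Rightarrow> real mat" where
  "sdo_C c = sdo_data_mat c"

definition sdo_A :: "real mat list \<Rightarrow> nat \<Rightarrow> real mat" where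
  "sdo_A A j = sdo_data_mat (map (\<lambda>Ai. row Ai j) A)"

text \<open>
  \<open>blk ns i\<close> is the (0-based) index of the first row of block \<open>i\<close>, i.e. \<open>u\<^bsub>i+1\<^esub> - 1\<close> for the
  1-based positions \<open>u\<close> counted over 1-based blocks; \<open>Cf ns h\<close> is the block containing row \<open>h\<close>.
\<close>

definition blk :: "nat list \<Rightarrow> nat \<Rightarrow> nat" where
  "blk ns i = (\<Sum>k<i. ns ! k)"

definition Cf :: "nat list \<Rightarrow> nat \<Rightarrow> nat" where
  "Cf ns h = (THE i. i < length ns \<and> blk ns i \<le> h \<and> h < blk ns (Suc i))"

definition idxI :: "nat list \<Rightarrow> (nat \<times> nat) set" where
  "idxI ns = {(h, l). h < l \<and> l < sum_list ns \<and>
     (blk ns (Suc (Cf ns h)) \<le> l \<or>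
      (blk ns (Cf ns h) < h \<and> l < blk ns (Suc (Cf ns h))))}"

definition idxK :: "nat list \<Rightarrow> nat set" where
  "idxK ns = {k. k < sum_list ns \<and> blk ns (Cf ns k) < k \<and> k < blk ns (Suc (Cf ns k))}"

definition sdo_A_check :: "nat list \<Rightarrow> nat \<times> nat \<Rightarrow> real mat" where
  "sdo_A_check ns = (\<lambda>(h, l). mat (sum_list ns) (sum_list ns)
     (\<lambda>(p, q). if (p, q) = (h, l) \<or> (p, q) = (l, h) then 1 else 0))"

definition sdo_A_hat :: "nat list \<Rightarrow> nat \<Rightarrow> real mat" where
  "sdo_A_hat ns k = mat (sum_list ns) (sum_list ns)
     (\<lambda>(p, q). if (p, q) = (k, k) then - 1
               else if (p, q) = (blk ns (Cf ns k), blk ns (Cf ns k)) then 1 else 0)"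

definition sdo_primal_feasible ::
    "nat list \<Rightarrow> nat \<Rightarrow> real mat list \<Rightarrow> real vec \<Rightarrow> real mat set" where
  "sdo_primal_feasible ns m A b =
     {X. (\<forall>j<m. trace_mat (sdo_A A j * X) = b $ j)
         \<and> (\<forall>hl \<in> idxI ns. trace_mat (sdo_A_check ns hl * X) = 0)
         \<and> (\<forall>k \<in> idxK ns. trace_mat (sdo_A_hat ns k * X) = 0)
         \<and> psd_mat (sum_list ns) X}"

definition sdo_dual_eq ::
    "nat list \<Rightarrow> nat \<Rightarrow> real mat list \<Rightarrow> real vec list \<Rightarrow> real vec \<Rightarrow> (nat \<times> nat \<Rightarrow> real)
     \<Rightarrow> (nat \<Rightarrow> real) \<Rightarrow> real mat \<Rightarrow> bool" where
  "sdo_dual_eq ns m A c y v z S \<longleftrightarrow>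
     lincomb_mat (sum_list ns) (\<lambda>j. y $ j) (sdo_A A) {..<m}
     + lincomb_mat (sum_list ns) v (sdo_A_check ns) (idxI ns)
     + lincomb_mat (sum_list ns) z (sdo_A_hat ns) (idxK ns)
     + S = sdo_C c"

text \<open>
  The multipliers \<open>v\<close> and \<open>z\<close> are families over the index sets; as total functions they are
  fixed to \<open>undefined\<close> outside, so that each family has a unique representation.
\<close>

type_synonym sdo_dual_point = "real vec \<times> (nat \<times> nat \<Rightarrow> real) \<times> (nat \<Rightarrow> real) \<times> real mat"

definition sdo_dual_feasible ::
    "nat list \<Rightarrow> nat \<Rightarrow> real mat list \<Rightarrow> real vec list \<Rightarrow> sdo_dual_point set" where
  "sdo_dual_feasible ns m A c =
     {(y, v, z, S). y \<in> carrier_vec m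
         \<and> v \<in> idxI ns \<rightarrow>\<^sub>E UNIV \<and> z \<in> idxK ns \<rightarrow>\<^sub>E UNIV
         \<and> sdo_dual_eq ns m A c y v z S
         \<and> psd_mat (sum_list ns) S}"

definition sdo_primal_obj :: "real vec list \<Rightarrow> real mat \<Rightarrow> real" where
  "sdo_primal_obj c X = trace_mat (sdo_C c * X)"


subsection \<open>The mappings and admissibility\<close>

type_synonym soco_point = "real vec list \<times> real vec \<times> real vec list"
type_synonym sdo_point = "real mat \<times> sdo_dual_point"

definition map_S :: "nat list \<Rightarrow> real vec list \<Rightarrow> real mat set" where
  "map_S ns s =
     {S. (\<exists>Ss. length Ss = length ns \<and> (\<forall>i<length ns. sym_mat (ns ! i) (Ss ! i))
              \<and> S = diag_block_mat Ss)
         \<and> psd_mat (sum_list ns) S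
         \<and> (\<forall>i<length ns.
              (\<Sum>j\<in>{blk ns i..<blk ns i + ns ! i}. S $$ (j, j)) = s ! i $ 0
              \<and> (\<forall>j\<in>{1..<ns ! i}. S $$ (blk ns i, blk ns i + j) = s ! i $ j / 2))}"

definition map_M ::
    "nat list \<Rightarrow> nat \<Rightarrow> real mat list \<Rightarrow> real vec list \<Rightarrow> soco_point \<Rightarrow> sdo_point set" where
  "map_M ns m A c = (\<lambda>(x, y, s).
     {(X, y', v, z, S). X = DArw x \<and> y' = y \<and> S \<in> map_S ns s
         \<and> v \<in> idxI ns \<rightarrow>\<^sub>E UNIV \<and> z \<in> idxK ns \<rightarrow>\<^sub>E UNIV
         \<and> sdo_dual_eq ns m A c y' v z S})"

definition map_M_inv :: "nat list \<Rightarrow> sdo_point \<Rightarrow> soco_point" where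
  "map_M_inv ns = (\<lambda>(X, y, v, z, S).
     (map (\<lambda>i. vec (ns ! i) (\<lambda>j. X $$ (blk ns i + j, blk ns i))) [0..<length ns],
      y,
      map (\<lambda>i. vec (ns ! i)
             (\<lambda>j. if j = 0 then \<Sum>p\<in>{blk ns i..<blk ns i + ns ! i}. S $$ (p, p)
                  else 2 * S $$ (blk ns i, blk ns i + j))) [0..<length ns]))"

text \<open>
  Points \<open>p\<close> and \<open>q\<close> of the two problem pairs correspond to each other if \<open>q \<in> M p\<close> or
  \<open>p = Minv q\<close>; both kinds of correspondence have to preserve the primal and the dual
  objective value.
\<close>

definition admissible_mapping ::
    "nat list \<Rightarrow> nat \<Rightarrow> real mat list \<Rightarrow> real vec \<Rightarrow> real vec list
     \<Rightarrow> (soco_point \<Rightarrow> sdo_point set) \<Rightarrow> (sdo_point \<Rightarrow> soco_point) \<Rightarrow> bool" where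
  "admissible_mapping ns m A b c M Minv \<longleftrightarrow>
     (let F = soco_primal_feasible ns m A b \<times> soco_dual_feasible ns m A c;
          G = sdo_primal_feasible ns m A b \<times> sdo_dual_feasible ns m A c;
          same_obj = (\<lambda>(x, y, s) (X, y', v, z, S).
             soco_primal_obj c x = sdo_primal_obj c X \<and> b \<bullet> y = b \<bullet> y')
      in (\<forall>p\<in>F. M p \<subseteq> G)
         \<and> (\<forall>q\<in>G. Minv q \<in> F)
         \<and> (\<forall>p\<in>F. \<forall>q\<in>M p. same_obj p q)
         \<and> (\<forall>q\<in>G. same_obj (Minv q) q))"

end

theory Submission
  imports Defs
begin

text \<open>
  The constraints indexed by \<open>\<I>\<close> and \<open>\<K>\<close> say exactly that \<open>X\<close> is block diagonal with arrow blocks,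
  and \<open>Arw x\<close> is positive semidefinite iff \<open>x\<close> lies in the Lorentz cone; hence \<open>DArw\<close> maps the SOCO
  primal feasible set onto the SDO primal feasible set. On the dual side, comparing entries of the
  equality constraint determines \<open>v\<close> off the arrows and \<open>z\<close> on the diagonal; what remains are the
  equations for the first row and the trace of each diagonal block of \<open>S\<close>, which are the SOCO dual
  equations. For a positive semidefinite \<open>S\<close>, \<open>S\<^sub>0\<^sub>j\<^sup>2 \<le> S\<^sub>0\<^sub>0 S\<^sub>j\<^sub>j\<close> and the inequality
  \<open>4 \<alpha> \<beta> \<le> (\<alpha> + \<beta>)\<^sup>2\<close> put the vector formed from trace and doubled first row in the cone, and
  conversely each cone vector arises from an explicit positive semidefinite block.
\<close>

section \<open>Block indices\<close>

lemma blk_0 [simp]: "blk ns 0 = 0"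
  by (simp add: blk_def)

lemma blk_Suc: "blk ns (Suc i) = blk ns i + ns ! i"
  by (simp add: blk_def)

lemma blk_mono: "i \<le> j \<Longrightarrow> blk ns i \<le> blk ns j"
  unfolding blk_def by (rule sum_mono2) auto

lemma blk_length: "blk ns (length ns) = sum_list ns"
  by (simp add: blk_def sum_list_sum_nth atLeast0LessThan)

lemma blk_Cons_Suc: "blk (n # ns) (Suc i) = n + blk ns i"
  by (induction i) (simp_all add: blk_Suc)

text \<open>For \<open>i < j\<close>, monotonicity of \<open>blk\<close> puts the end of block
  \<open>i\<close> at or before the start of block \<open>j\<close>. So a row has at most one pair
  of block number and offset.\<close>

lemma blk_add_inj:
  assumes "a < ns ! i" "b < ns ! j" "blk ns i + a = blk ns j + b"
  shows "i = j \<and> a = b"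
proof -
  have "\<not> i < j" using blk_mono[of "Suc i" j ns] assms by (auto simp: blk_Suc Suc_le_eq)
  moreover have "\<not> j < i" using blk_mono[of "Suc j" i ns] assms by (auto simp: blk_Suc Suc_le_eq)
  ultimately show ?thesis using assms by auto
qed

lemma blk_add_less:
  assumes "i < length ns" "a < ns ! i"
  shows "blk ns i + a < sum_list ns"
  using blk_mono[of "Suc i" "length ns" ns] assms by (simp add: blk_Suc blk_length)

text \<open>Existence of such coordinates. The bound is \<open>blk ns r\<close> for an arbitrary
  number \<open>r\<close> of blocks so that induction on \<open>r\<close> applies.\<close>

lemma less_blk_obtain:
  assumes "p < blk ns r"
  obtains i a where "i < r" "a < ns ! i" "p = blk ns i + a"
proof -
  have "\<exists>i<r. \<exists>a<ns ! i. p = blk ns i + a" using assms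
  proof (induction r)
    case (Suc r)
    show ?case
    proof (cases "p < blk ns r")
      case True
      then show ?thesis using Suc.IH less_Suc_eq by blast
    next
      case False
      then show ?thesis
        using Suc.prems by (intro exI[of _ r] conjI exI[of _ "p - blk ns r"]) (auto simp: blk_Suc)
    qed
  qed simp
  then show ?thesis using that by blast
qed

lemma block_index_obtain:
  assumes "p < sum_list ns"
  obtains i a where "i < length ns" "a < ns ! i" "p = blk ns i + a"
  using assms less_blk_obtain[of p ns "length ns"] by (auto simp: blk_length)

text \<open>Turns the definite description in \<open>Cf\<close> into a rewrite rule; later arguments
  about \<open>Cf\<close> go through it.\<close>

lemma Cf_blk_add:
  assumes "i < length ns" "a < ns ! i"
  shows "Cf ns (blk ns i + a) = i"
  unfolding Cf_def
proof (rule the_equality)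
  fix j assume j: "j < length ns \<and> blk ns j \<le> blk ns i + a \<and> blk ns i + a < blk ns (Suc j)"
  then show "j = i"
    using blk_add_inj[of a ns i "blk ns i + a - blk ns j" j] assms by (auto simp: blk_Suc)
qed (use assms in \<open>auto simp: blk_Suc\<close>)

lemma sum_blk:
  "(\<Sum>p<blk ns r. f p) = (\<Sum>i<r. \<Sum>a<ns ! i. f (blk ns i + a))"
proof (induction r)
  case (Suc r)
  have "(\<Sum>p<blk ns (Suc r). f p) = (\<Sum>p<blk ns r. f p) + (\<Sum>a<ns ! r. f (blk ns r + a))"
    using sum.atLeastLessThan_concat[of 0 "blk ns r" "blk ns r + ns ! r" f]
      sum.shift_bounds_nat_ivl[of f 0 "blk ns r" "ns ! r"]
    by (simp add: blk_Suc lessThan_atLeast0 add.commute[of _ "blk ns r"])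
  then show ?case using Suc by simp
qed simp

lemma sum_blocks:
  "(\<Sum>p<sum_list ns. f p) = (\<Sum>i<length ns. \<Sum>a<ns ! i. f (blk ns i + a))"
  using sum_blk[of f ns "length ns"] by (simp add: blk_length)

lemma mat_eq_blocksI:
  assumes "A \<in> carrier_mat (sum_list ns) (sum_list ns)" "B \<in> carrier_mat (sum_list ns) (sum_list ns)"
    and "\<And>i a j b. i < length ns \<Longrightarrow> a < ns ! i \<Longrightarrow> j < length ns \<Longrightarrow> b < ns ! j \<Longrightarrow>
      A $$ (blk ns i + a, blk ns j + b) = B $$ (blk ns i + a, blk ns j + b)"
  shows "A = B"
proof (rule eq_matI)
  fix p q assume "p < dim_row B" "q < dim_col B"
  then have pq: "p < sum_list ns" "q < sum_list ns" using assms(2) by auto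
  obtain i a where i: "i < length ns" "a < ns ! i" "p = blk ns i + a"
    using pq(1) by (rule block_index_obtain)
  obtain j b where j: "j < length ns" "b < ns ! j" "q = blk ns j + b"
    using pq(2) by (rule block_index_obtain)
  show "A $$ (p, q) = B $$ (p, q)" using assms(3)[OF i(1,2) j(1,2)] i(3) j(3) by simp
qed (use assms in auto)

lemma sum_single_block:
  fixes g :: "nat \<Rightarrow> 'a::comm_monoid_add"
  assumes "i < length ns"
    and "\<And>j b. j < length ns \<Longrightarrow> j \<noteq> i \<Longrightarrow> b < ns ! j \<Longrightarrow> g (blk ns j + b) = 0"
  shows "(\<Sum>q<sum_list ns. g q) = (\<Sum>b<ns ! i. g (blk ns i + b))"
proof -
  have "(\<Sum>q<sum_list ns. g q) = (\<Sum>j<length ns. if j = i then \<Sum>b<ns ! i. g (blk ns i + b) else 0)"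
    unfolding sum_blocks using assms(2) by (intro sum.cong refl) auto
  then show ?thesis using assms(1) by simp
qed

text \<open>The condition \<open>h < l\<close> in \<open>idxI\<close> excludes \<open>j < i\<close>.
  The first row of a block has offset 0, so the off-arrow case inside a block reads
  \<open>0 < a\<close>.\<close>

lemma idxI_blk_iff:
  assumes "i < length ns" "a < ns ! i" "j < length ns" "b < ns ! j"
  shows "(blk ns i + a, blk ns j + b) \<in> idxI ns \<longleftrightarrow> i < j \<or> (i = j \<and> 0 < a \<and> a < b)"
proof -
  have "i < j \<Longrightarrow> blk ns i + ns ! i \<le> blk ns j"
    using blk_mono[of "Suc i" j ns] by (simp add: blk_Suc)
  moreover have "j < i \<Longrightarrow> blk ns j + ns ! j \<le> blk ns i"
    using blk_mono[of "Suc j" i ns] by (simp add: blk_Suc)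
  ultimately show ?thesis
    using assms blk_add_less[OF assms(3,4)]
    by (cases i j rule: linorder_cases) (auto simp: idxI_def Cf_blk_add blk_Suc)
qed

lemma idxI_asym: "(p, q) \<in> idxI ns \<Longrightarrow> (q, p) \<notin> idxI ns"
  by (auto simp: idxI_def)

lemma idxK_blk_iff:
  assumes "i < length ns" "a < ns ! i"
  shows "blk ns i + a \<in> idxK ns \<longleftrightarrow> 0 < a"
  using assms blk_add_less[OF assms] by (auto simp: idxK_def Cf_blk_add blk_Suc)

lemma finite_idxI [simp]: "finite (idxI ns)"
  by (rule finite_subset[of _ "{..<sum_list ns} \<times> {..<sum_list ns}"]) (auto simp: idxI_def)

section \<open>Block diagonal and arrow matrices\<close>

lemma diag_block_mat_carrier:
  assumes "length Bs = length ns" "\<forall>i<length ns. Bs ! i \<in> carrier_mat (ns ! i) (ns ! i)"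
  shows "diag_block_mat Bs \<in> carrier_mat (sum_list ns) (sum_list ns)"
proof -
  have "map dim_row Bs = ns" "map dim_col Bs = ns"
    using assms by (auto intro!: nth_equalityI)
  then show ?thesis by (intro carrier_matI) (simp_all add: dim_diag_block_mat)
qed

lemma index_diag_block_mat:
  assumes "length Bs = length ns" "\<forall>i<length ns. Bs ! i \<in> carrier_mat (ns ! i) (ns ! i)"
    and "i < length ns" "a < ns ! i" "j < length ns" "b < ns ! j"
  shows "diag_block_mat Bs $$ (blk ns i + a, blk ns j + b) = (if i = j then Bs ! i $$ (a, b) else 0)"
  using assms
proof (induction Bs arbitrary: ns i j)
  case (Cons B Bs)
  then obtain n ns' where ns: "ns = n # ns'" by (cases ns) auto
  have len: "length Bs = length ns'" using Cons.prems ns by simp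
  have car: "\<forall>i<length ns'. Bs ! i \<in> carrier_mat (ns' ! i) (ns' ! i)"
    using Cons.prems(2) ns by (metis Suc_less_eq length_Cons nth_Cons_Suc)
  have B: "B \<in> carrier_mat n n" using Cons.prems(2) ns by (metis length_Cons nth_Cons_0 zero_less_Suc)
  have D: "diag_block_mat Bs \<in> carrier_mat (sum_list ns') (sum_list ns')"
    by (rule diag_block_mat_carrier[OF len car])
  have bound: "blk ns' k + e < sum_list ns'" if "Suc k < length ns" "e < ns ! Suc k" for k e
    using that ns by (auto intro: blk_add_less)
  have IH: "diag_block_mat Bs $$ (blk ns' k + a, blk ns' l + b) = (if k = l then Bs ! k $$ (a, b) else 0)"
    if "i = Suc k" "j = Suc l" for k l
    using Cons.IH[OF len car, of k l] Cons.prems ns that by simp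
  \<comment> \<open>The cases zero and successor for \<open>i\<close> and \<open>j\<close> are the
    four quadrants of the block matrix; in the lower right one, all indices are shifted by the size
    of the first block.\<close>
  show ?case
    using Cons.prems B D IH bound ns
    by (cases i; cases j) (auto simp: Let_def index_mat_four_block blk_Cons_Suc)
qed simp

lemma Arw_carrier: "x \<in> carrier_vec n \<Longrightarrow> Arw x \<in> carrier_mat n n"
  by (simp add: Arw_def)

lemma index_Arw:
  assumes "x \<in> carrier_vec n" "a < n" "b < n"
  shows "Arw x $$ (a, b) = (if a = b then x $ 0 else if a = 0 then x $ b else if b = 0 then x $ a else 0)"
  using assms by (simp add: Arw_def)

lemma DArw_carrier:
  assumes "length xs = length ns" "\<forall>i<length ns. xs ! i \<in> carrier_vec (ns ! i)"
  shows "DArw xs \<in> carrier_mat (sum_list ns) (sum_list ns)"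
  unfolding DArw_def using assms by (intro diag_block_mat_carrier) (auto simp: Arw_carrier)

lemma index_DArw:
  assumes "length xs = length ns" "\<forall>i<length ns. xs ! i \<in> carrier_vec (ns ! i)"
    and "i < length ns" "a < ns ! i" "j < length ns" "b < ns ! j"
  shows "DArw xs $$ (blk ns i + a, blk ns j + b) =
    (if i \<noteq> j then 0 else if a = b then xs ! i $ 0 else if a = 0 then xs ! i $ b
     else if b = 0 then xs ! i $ a else 0)"
  unfolding DArw_def using assms
  by (subst index_diag_block_mat[of _ ns]) (auto simp: Arw_carrier index_Arw)

lemma sum_lessThan_split_first:
  fixes f :: "nat \<Rightarrow> 'a::comm_monoid_add"
  assumes "1 \<le> n"
  shows "(\<Sum>a<n. f a) = f 0 + (\<Sum>a\<in>{1..<n}. f a)"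
  using assms by (simp add: lessThan_atLeast0 sum.atLeast_Suc_lessThan)

text \<open>In a row with \<open>0 < a\<close> only column 0 and the diagonal survive. This serves
  both the trace inner product and the quadratic form of an arrow matrix.\<close>

lemma sum_arrow:
  fixes g :: "nat \<Rightarrow> nat \<Rightarrow> 'a::comm_monoid_add"
  assumes "1 \<le> n" "\<And>a b. a < n \<Longrightarrow> b < n \<Longrightarrow> 0 < a \<Longrightarrow> 0 < b \<Longrightarrow> a \<noteq> b \<Longrightarrow> g a b = 0"
  shows "(\<Sum>a<n. \<Sum>b<n. g a b) = (\<Sum>a<n. g a a) + (\<Sum>a\<in>{1..<n}. g 0 a + g a 0)"
proof -
  have "(\<Sum>b\<in>{1..<n}. g a b) = g a a" if "a \<in> {1..<n}" for a
  proof -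
    have "(\<Sum>b\<in>{1..<n}. g a b) = (\<Sum>b\<in>{1..<n}. if b = a then g a a else 0)"
      using assms that by (intro sum.cong) auto
    then show ?thesis using that by simp
  qed
  then have "(\<Sum>a\<in>{1..<n}. \<Sum>b<n. g a b) = (\<Sum>a\<in>{1..<n}. g a 0 + g a a)"
    by (simp add: sum_lessThan_split_first[OF assms(1)])
  then show ?thesis
    by (simp add: sum_lessThan_split_first[OF assms(1)] sum.distrib ac_simps)
qed

section \<open>Positive semidefinite matrices\<close>

lemma quadratic_form_sum:
  assumes "A \<in> carrier_mat k k" "w \<in> carrier_vec k"
  shows "w \<bullet> (A *\<^sub>v w) = (\<Sum>p<k. \<Sum>q<k. w $ p * A $$ (p, q) * w $ q)"
  using assms by (simp add: scalar_prod_def lessThan_atLeast0 sum_distrib_left mult.assoc)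

lemma sym_mat_iff:
  "sym_mat k A \<longleftrightarrow> A \<in> carrier_mat k k \<and> (\<forall>p<k. \<forall>q<k. A $$ (p, q) = A $$ (q, p))"
  unfolding sym_mat_def by (auto simp: mat_eq_iff)

text \<open>Test vectors become plain functions, so that they can be given by cases and the double
  sum can be reindexed.\<close>

lemma psd_mat_iff:
  "psd_mat k A \<longleftrightarrow> A \<in> carrier_mat k k \<and> (\<forall>p<k. \<forall>q<k. A $$ (p, q) = A $$ (q, p))
     \<and> (\<forall>f::nat \<Rightarrow> real. 0 \<le> (\<Sum>p<k. \<Sum>q<k. f p * A $$ (p, q) * f q))"
proof -
  have "(\<forall>w \<in> carrier_vec k. w \<bullet> (A *\<^sub>v w) \<ge> 0) \<longleftrightarrow>
     (\<forall>f::nat \<Rightarrow> real. 0 \<le> (\<Sum>p<k. \<Sum>q<k. f p * A $$ (p, q) * f q))" (is "?L \<longleftrightarrow> ?R")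
    if A: "A \<in> carrier_mat k k"
  proof
    assume L: ?L
    show ?R
    proof
      fix f :: "nat \<Rightarrow> real"
      have "0 \<le> vec k f \<bullet> (A *\<^sub>v vec k f)" using L by simp
      then show "0 \<le> (\<Sum>p<k. \<Sum>q<k. f p * A $$ (p, q) * f q)"
        by (simp add: quadratic_form_sum[OF A])
    qed
  next
    assume ?R
    then show ?L by (simp add: quadratic_form_sum[OF A])
  qed
  then show ?thesis unfolding psd_mat_def sym_mat_iff by auto
qed

section \<open>Principal submatrices and block diagonal assembly\<close>

lemma sum_extend_inj:
  assumes "inj_on \<sigma> {..<n}" "\<sigma> ` {..<n} \<subseteq> {..<k::nat}"
    and "\<And>p. p < k \<Longrightarrow> p \<notin> \<sigma> ` {..<n} \<Longrightarrow> g p = (0::real)"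
  shows "(\<Sum>p<k. g p) = (\<Sum>a<(n::nat). g (\<sigma> a))"
proof -
  have "(\<Sum>p<k. g p) = (\<Sum>p\<in>\<sigma> ` {..<n}. g p)"
    using assms by (intro sum.mono_neutral_right) auto
  also have "\<dots> = (\<Sum>a<n. g (\<sigma> a))" using assms(1) by (simp add: sum.reindex)
  finally show ?thesis .
qed

text \<open>A test vector for the submatrix is extended by zero. As \<open>\<sigma>\<close> is any
  injection, this covers diagonal blocks as well as the minors on two arbitrary indices.\<close>

lemma psd_principal_submatrix:
  assumes "psd_mat k A" "inj_on \<sigma> {..<n}" "\<sigma> ` {..<n} \<subseteq> {..<k}"
  shows "psd_mat n (mat n n (\<lambda>(a, b). A $$ (\<sigma> a, \<sigma> b)))"
proof -
  have "0 \<le> (\<Sum>a<n. \<Sum>b<n. f a * A $$ (\<sigma> a, \<sigma> b) * f b)" for f :: "nat \<Rightarrow> real"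
  proof -
    define g where "g p = (if p \<in> \<sigma> ` {..<n} then f (the_inv_into {..<n} \<sigma> p) else 0)" for p
    have g: "g (\<sigma> a) = f a" if "a < n" for a
      using that by (simp add: g_def the_inv_into_f_f[OF assms(2)])
    have "0 \<le> (\<Sum>p<k. \<Sum>q<k. g p * A $$ (p, q) * g q)" using assms(1) by (simp add: psd_mat_iff)
    also have "\<dots> = (\<Sum>a<n. \<Sum>q<k. g (\<sigma> a) * A $$ (\<sigma> a, q) * g q)"
      by (rule sum_extend_inj[OF assms(2,3)]) (simp add: g_def)
    also have "\<dots> = (\<Sum>a<n. \<Sum>b<n. g (\<sigma> a) * A $$ (\<sigma> a, \<sigma> b) * g (\<sigma> b))"
      by (intro sum.cong refl sum_extend_inj[OF assms(2,3)]) (simp add: g_def)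
    also have "\<dots> = (\<Sum>a<n. \<Sum>b<n. f a * A $$ (\<sigma> a, \<sigma> b) * f b)" by (simp add: g)
    finally show ?thesis .
  qed
  moreover have "A $$ (\<sigma> a, \<sigma> b) = A $$ (\<sigma> b, \<sigma> a)" if "a < n" "b < n" for a b
    using that assms unfolding psd_mat_iff by blast
  ultimately show ?thesis by (simp add: psd_mat_iff)
qed

lemma psd_diag_block:
  assumes "psd_mat (sum_list ns) S" "i < length ns"
  shows "psd_mat (ns ! i) (mat (ns ! i) (ns ! i) (\<lambda>(a, b). S $$ (blk ns i + a, blk ns i + b)))"
  using assms by (intro psd_principal_submatrix) (auto simp: inj_on_def blk_add_less)

text \<open>The quadratic form splits into the sum of the forms of the blocks, each evaluated at the
  corresponding segment of the test vector.\<close>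

lemma psd_diag_block_mat:
  assumes "length Bs = length ns" "\<forall>i<length ns. psd_mat (ns ! i) (Bs ! i)"
  shows "psd_mat (sum_list ns) (diag_block_mat Bs)"
proof -
  have car: "\<forall>i<length ns. Bs ! i \<in> carrier_mat (ns ! i) (ns ! i)"
    using assms by (simp add: psd_mat_iff)
  note idx = index_diag_block_mat[OF assms(1) car]
  let ?D = "diag_block_mat Bs"
  have "?D $$ (p, q) = ?D $$ (q, p)" if pq: "p < sum_list ns" "q < sum_list ns" for p q
  proof -
    obtain i a where i: "i < length ns" "a < ns ! i" "p = blk ns i + a"
      using pq(1) by (rule block_index_obtain)
    obtain j b where j: "j < length ns" "b < ns ! j" "q = blk ns j + b"
      using pq(2) by (rule block_index_obtain)
    show ?thesis using i j assms(2) by (auto simp: idx psd_mat_iff)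
  qed
  moreover have "0 \<le> (\<Sum>p<sum_list ns. \<Sum>q<sum_list ns. f p * ?D $$ (p, q) * f q)" for f :: "nat \<Rightarrow> real"
  proof -
    have "(\<Sum>q<sum_list ns. f (blk ns i + a) * ?D $$ (blk ns i + a, q) * f q)
      = (\<Sum>b<ns ! i. f (blk ns i + a) * Bs ! i $$ (a, b) * f (blk ns i + b))"
      if i: "i < length ns" "a < ns ! i" for i a
      using i by (subst sum_single_block) (auto simp: idx)
    then have "(\<Sum>p<sum_list ns. \<Sum>q<sum_list ns. f p * ?D $$ (p, q) * f q)
      = (\<Sum>i<length ns. \<Sum>a<ns ! i. \<Sum>b<ns ! i. f (blk ns i + a) * Bs ! i $$ (a, b) * f (blk ns i + b))"
      by (subst sum_blocks) simp
    also have "\<dots> \<ge> 0"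
    proof (rule sum_nonneg)
      fix i assume "i \<in> {..<length ns}"
      then show "0 \<le> (\<Sum>a<ns ! i. \<Sum>b<ns ! i. f (blk ns i + a) * Bs ! i $$ (a, b) * f (blk ns i + b))"
        using assms(2) unfolding psd_mat_iff lessThan_iff by (elim allE[of _ i]) auto
    qed
    finally show ?thesis .
  qed
  ultimately show ?thesis using diag_block_mat_carrier[OF assms(1) car] by (auto simp: psd_mat_iff)
qed

lemma psd_quadratic_form:
  fixes f :: "nat \<Rightarrow> real"
  shows "psd_mat k A \<Longrightarrow> 0 \<le> (\<Sum>p<k. \<Sum>q<k. f p * A $$ (p, q) * f q)"
  by (simp add: psd_mat_iff)

section \<open>Arrow matrices and the Lorentz cone\<close>

lemma arrow_quadratic_form:
  assumes "x \<in> carrier_vec n" "1 \<le> n"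
  shows "(\<Sum>a<n. \<Sum>b<n. f a * Arw x $$ (a, b) * f b)
    = x $ 0 * (\<Sum>a<n. (f a)\<^sup>2) + 2 * f 0 * (\<Sum>a\<in>{1..<n}. x $ a * f a)"
proof -
  have "(\<Sum>a<n. \<Sum>b<n. f a * Arw x $$ (a, b) * f b)
    = (\<Sum>a<n. f a * Arw x $$ (a, a) * f a)
      + (\<Sum>a\<in>{1..<n}. f 0 * Arw x $$ (0, a) * f a + f a * Arw x $$ (a, 0) * f 0)"
    using assms by (intro sum_arrow) (auto simp: index_Arw)
  also have "\<dots> = (\<Sum>a<n. x $ 0 * (f a)\<^sup>2) + (\<Sum>a\<in>{1..<n}. 2 * f 0 * (x $ a * f a))"
    using assms by (intro arg_cong2[of _ _ _ _ "(+)"] sum.cong refl)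
      (auto simp: index_Arw power2_eq_square)
  finally show ?thesis by (simp add: sum_distrib_left)
qed

lemma L2_set_squared: "(L2_set f A)\<^sup>2 = (\<Sum>a\<in>A. (f a)\<^sup>2)"
  by (simp add: L2_set_def sum_nonneg)

text \<open>A single well-chosen test vector yields the cone inequality; the converse is
  Cauchy-Schwarz together with a square.\<close>

lemma psd_Arw_iff:
  assumes x: "x \<in> carrier_vec n" and n: "1 \<le> n"
  shows "psd_mat n (Arw x) \<longleftrightarrow> x \<in> lorentz_cone n"
proof
  let ?L = "L2_set (\<lambda>j. x $ j) {1..<n}"
  assume psd: "psd_mat n (Arw x)"
  have Q: "0 \<le> x $ 0 * (\<Sum>a<n. (f a)\<^sup>2) + 2 * f 0 * (\<Sum>a\<in>{1..<n}. x $ a * f a)" for f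
    using psd unfolding psd_mat_iff arrow_quadratic_form[OF assms] by blast
  have x0: "0 \<le> x $ 0"
    using Q[of "\<lambda>a. if a = 0 then 1 else 0"] by (simp add: sum_lessThan_split_first[OF n])
  \<comment> \<open>The test vector has first entry \<open>?L\<close> and otherwise the entries of
    \<open>- x\<close>, the direction in which the mixed term is most negative.\<close>
  have "0 \<le> x $ 0 * (?L\<^sup>2 + ?L\<^sup>2) - 2 * ?L * ?L\<^sup>2"
    using Q[of "\<lambda>a. if a = 0 then ?L else - x $ a"]
    by (simp add: sum_lessThan_split_first[OF n] L2_set_squared sum_negf
        flip: power2_eq_square)
  then have "0 \<le> 2 * ?L\<^sup>2 * (x $ 0 - ?L)" by (simp add: algebra_simps)
  \<comment> \<open>For \<open>?L = 0\<close> the previous inequality carries no information, and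
    \<open>x0\<close> takes its place.\<close>
  then have "?L \<le> x $ 0" using x0 by (cases "?L = 0") (auto simp: zero_le_mult_iff)
  then show "x \<in> lorentz_cone n" using x by (simp add: lorentz_cone_def)
next
  let ?L = "L2_set (\<lambda>j. x $ j) {1..<n}"
  assume "x \<in> lorentz_cone n"
  then have L: "?L \<le> x $ 0" by (simp add: lorentz_cone_def)
  have "0 \<le> x $ 0 * (\<Sum>a<n. (f a)\<^sup>2) + 2 * f 0 * (\<Sum>a\<in>{1..<n}. x $ a * f a)" for f
  proof -
    let ?F = "L2_set f {1..<n}"
    have "\<bar>\<Sum>a\<in>{1..<n}. x $ a * f a\<bar> \<le> (\<Sum>a\<in>{1..<n}. \<bar>x $ a\<bar> * \<bar>f a\<bar>)"
      using sum_abs[of "\<lambda>a. x $ a * f a" "{1..<n}"] by (simp add: abs_mult)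
    also have "\<dots> \<le> ?L * ?F" by (rule L2_set_mult_ineq)
    finally have cs: "\<bar>f 0\<bar> * \<bar>\<Sum>a\<in>{1..<n}. x $ a * f a\<bar> \<le> \<bar>f 0\<bar> * (?L * ?F)"
      by (intro mult_left_mono) auto
    \<comment> \<open>Expanding this square produces the Cauchy-Schwarz bound of the mixed term;
      afterwards the factor \<open>?L\<close> is enlarged to \<open>x $ 0\<close> by the cone
      inequality.\<close>
    have "0 \<le> ?L * (\<bar>f 0\<bar> - ?F)\<^sup>2" by simp
    also have "\<dots> = ?L * ((f 0)\<^sup>2 + ?F\<^sup>2) - 2 * (\<bar>f 0\<bar> * (?L * ?F))"
      by (simp add: power2_eq_square algebra_simps)
    also have "\<dots> \<le> x $ 0 * ((f 0)\<^sup>2 + ?F\<^sup>2) - 2 * (\<bar>f 0\<bar> * \<bar>\<Sum>a\<in>{1..<n}. x $ a * f a\<bar>)"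
      using mult_right_mono[OF L, of "(f 0)\<^sup>2 + ?F\<^sup>2"] cs by simp
    also have "\<dots> \<le> x $ 0 * ((f 0)\<^sup>2 + ?F\<^sup>2) + 2 * f 0 * (\<Sum>a\<in>{1..<n}. x $ a * f a)"
      using abs_ge_minus_self[of "f 0 * (\<Sum>a\<in>{1..<n}. x $ a * f a)"] by (simp add: abs_mult)
    finally show ?thesis by (simp add: sum_lessThan_split_first[OF n] L2_set_squared)
  qed
  moreover have "Arw x $$ (p, q) = Arw x $$ (q, p)" if "p < n" "q < n" for p q
    using x that by (auto simp: index_Arw)
  ultimately show "psd_mat n (Arw x)"
    using Arw_carrier[OF x] by (simp add: psd_mat_iff arrow_quadratic_form[OF assms])
qed

section \<open>Traces and first rows of positive semidefinite blocks\<close>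

text \<open>Restriction to the indices \<open>p\<close> and \<open>q\<close> leaves a binary
  quadratic form, and suitable test vectors bound its discriminant.\<close>

lemma psd_minor_le:
  assumes psd: "psd_mat k A" and "p < k" "q < k" "p \<noteq> q"
  shows "(A $$ (p, q))\<^sup>2 \<le> A $$ (p, p) * A $$ (q, q)"
proof -
  let ?\<sigma> = "\<lambda>a::nat. if a = 0 then p else q"
  let ?a = "A $$ (p, p)" and ?b = "A $$ (p, q)" and ?d = "A $$ (q, q)"
  have two: "{..<2} = {0, 1::nat}" by auto
  have "psd_mat 2 (mat 2 2 (\<lambda>(a, b). A $$ (?\<sigma> a, ?\<sigma> b)))"
    using assms by (intro psd_principal_submatrix[OF psd]) (auto simp: inj_on_def two)
  then have "0 \<le> (\<Sum>a<2. \<Sum>b<2. f a * A $$ (?\<sigma> a, ?\<sigma> b) * f b)" for f :: "nat \<Rightarrow> real"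
    unfolding psd_mat_iff by simp
  moreover have "A $$ (q, p) = ?b" using assms by (simp add: psd_mat_iff)
  ultimately have "0 \<le> f 0 * ?a * f 0 + f 0 * ?b * f 1 + (f 1 * ?b * f 0 + f 1 * ?d * f 1)"
    for f :: "nat \<Rightarrow> real"
    by (simp add: two)
  from this[of "\<lambda>i. if i = 0 then _ else _"]
  have Q: "0 \<le> s * ?a * s + s * ?b * t + (t * ?b * s + t * ?d * t)" for s t by simp
  have a: "0 \<le> ?a" using Q[of 1 0] by simp
  show ?thesis
  proof (cases "?a = 0")
    case True
    \<comment> \<open>For \<open>?a = 0\<close> and nonzero \<open>?b\<close>, this test vector
      would give the form the value -1.\<close>
    then have "?b = 0" using Q[of "- (?d + 1) / (2 * ?b)" 1] by (cases "?b = 0") (auto simp: field_simps)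
    then show ?thesis using True by simp
  next
    case False
    have "0 \<le> ?a * (?a * ?d - ?b\<^sup>2)"
      using Q[of "- ?b" ?a] by (simp add: power2_eq_square algebra_simps)
    then show ?thesis using a False by (simp add: zero_le_mult_iff)
  qed
qed

text \<open>Adding the 2 by 2 minors along the first row bounds the squared norm by four times the
  corner entry times the rest of the trace, hence by the square of the trace.\<close>

lemma psd_trace_row_in_lorentz_cone:
  assumes psd: "psd_mat n B" and n: "1 \<le> n"
  shows "vec n (\<lambda>j. if j = 0 then \<Sum>p<n. B $$ (p, p) else 2 * B $$ (0, j)) \<in> lorentz_cone n"
proof -
  let ?T = "\<Sum>j\<in>{1..<n}. B $$ (j, j)"
  have diag: "0 \<le> B $$ (p, p)" if "p < n" for p
  proof -
    have "0 \<le> (\<Sum>q<n. \<Sum>r<n. (if q = p then 1 else 0) * B $$ (q, r) * (if r = p then 1 else 0))"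
      using psd_quadratic_form[OF psd, of "\<lambda>q. if q = p then 1 else 0"] .
    also have "\<dots> = B $$ (p, p)"
      using that by (simp add: if_distrib[of "\<lambda>u. u * _"] if_distrib[of "\<lambda>u. _ * u"] cong: if_cong)
    finally show ?thesis .
  qed
  have T: "0 \<le> ?T" using diag by (intro sum_nonneg) auto
  have "(\<Sum>j\<in>{1..<n}. (2 * B $$ (0, j))\<^sup>2) \<le> (\<Sum>j\<in>{1..<n}. 4 * B $$ (0, 0) * B $$ (j, j))"
    using psd_minor_le[OF psd, of 0] n by (intro sum_mono) (auto simp: power_mult_distrib)
  also have "\<dots> = 4 * B $$ (0, 0) * ?T" by (simp add: sum_distrib_left)
  also have "\<dots> \<le> (B $$ (0, 0) + ?T)\<^sup>2"
    using zero_le_power2[of "B $$ (0, 0) - ?T"] by (simp add: power2_eq_square algebra_simps)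
  finally have "L2_set (\<lambda>j. 2 * B $$ (0, j)) {1..<n} \<le> B $$ (0, 0) + ?T"
    unfolding L2_set_def using T diag[of 0] n by (intro real_le_lsqrt) auto
  then have "L2_set (\<lambda>j. 2 * B $$ (0, j)) {1..<n} \<le> (\<Sum>p<n. B $$ (p, p))"
    using n by (simp add: sum_lessThan_split_first)
  moreover have "L2_set (\<lambda>j. 2 * B $$ (0, j)) {1..<n}
     = L2_set (\<lambda>j. vec n (\<lambda>j. if j = 0 then \<Sum>p<n. B $$ (p, p) else 2 * B $$ (0, j)) $ j) {1..<n}"
    by (intro L2_set_cong) auto
  ultimately show ?thesis using n by (simp add: lorentz_cone_def)
qed

text \<open>
  The lower right part has rank one, so that the quadratic form of the matrix is a completed square
  plus a multiple of the square of the first coordinate, which is nonnegative for \<open>s\<close> in the cone.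
  If \<open>s $ 0 = 0\<close> there, then \<open>s = 0\<close>, and the divisions by zero give the zero matrix.
\<close>

definition cone_lift :: "real vec \<Rightarrow> real mat" where
  "cone_lift s = mat (dim_vec s) (dim_vec s)
     (\<lambda>(a, b). if a = 0 \<and> b = 0 then s $ 0 - (\<Sum>j\<in>{1..<dim_vec s}. (s $ j)\<^sup>2) / (2 * s $ 0)
               else if a = 0 then s $ b / 2 else if b = 0 then s $ a / 2
               else s $ a * s $ b / (2 * s $ 0))"

lemma cone_lift_first_row:
  "s \<in> carrier_vec n \<Longrightarrow> 0 < j \<Longrightarrow> j < n \<Longrightarrow> cone_lift s $$ (0, j) = s $ j / 2"
  by (simp add: cone_lift_def)

text \<open>The corner entry of \<open>cone_lift\<close> is what the rest of the diagonal leaves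
  over from \<open>s $ 0\<close>. The cancellation also holds for the value that division by zero
  takes.\<close>

lemma trace_cone_lift:
  assumes "s \<in> carrier_vec n" "1 \<le> n"
  shows "(\<Sum>p<n. cone_lift s $$ (p, p)) = s $ 0"
proof -
  have "(\<Sum>p\<in>{1..<n}. cone_lift s $$ (p, p)) = (\<Sum>p\<in>{1..<n}. (s $ p)\<^sup>2) / (2 * s $ 0)"
    unfolding sum_divide_distrib using assms
    by (intro sum.cong) (auto simp: cone_lift_def power2_eq_square)
  moreover have "cone_lift s $$ (0, 0) = s $ 0 - (\<Sum>p\<in>{1..<n}. (s $ p)\<^sup>2) / (2 * s $ 0)"
    using assms by (simp add: cone_lift_def)
  ultimately show ?thesis by (simp add: sum_lessThan_split_first[OF assms(2)])
qed

lemma psd_cone_lift: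
  assumes s: "s \<in> lorentz_cone n" and n: "1 \<le> n"
  shows "psd_mat n (cone_lift s)"
proof -
  let ?N = "\<Sum>j\<in>{1..<n}. (s $ j)\<^sup>2"
  have car: "s \<in> carrier_vec n" and L: "L2_set (\<lambda>j. s $ j) {1..<n} \<le> s $ 0"
    using s by (auto simp: lorentz_cone_def)
  have s0: "0 \<le> s $ 0" using order_trans[OF L2_set_nonneg L] .
  have N: "?N \<le> (s $ 0)\<^sup>2"
    using power_mono[OF L L2_set_nonneg, of 2] by (simp add: L2_set_squared)
  have "0 \<le> (\<Sum>a<n. \<Sum>b<n. f a * cone_lift s $$ (a, b) * f b)" for f :: "nat \<Rightarrow> real"
  proof -
    let ?X = "\<Sum>a\<in>{1..<n}. s $ a * f a"
    have "(\<Sum>a<n. \<Sum>b<n. f a * cone_lift s $$ (a, b) * f b)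
      = f 0 * (s $ 0 - ?N / (2 * s $ 0)) * f 0 + (\<Sum>b\<in>{1..<n}. f 0 / 2 * (s $ b * f b))
        + (\<Sum>a\<in>{1..<n}. f 0 / 2 * (s $ a * f a))
        + (\<Sum>a\<in>{1..<n}. \<Sum>b\<in>{1..<n}. (s $ a * f a) * (s $ b * f b) / (2 * s $ 0))"
      using n car by (simp add: sum_lessThan_split_first sum.distrib cone_lift_def mult_ac)
    also have "\<dots> = (f 0)\<^sup>2 * (s $ 0 - ?N / (2 * s $ 0)) + f 0 * ?X + ?X\<^sup>2 / (2 * s $ 0)"
      unfolding sum_divide_distrib[symmetric] sum_product[symmetric]
      unfolding sum_distrib_left[symmetric]
      by (simp add: power2_eq_square)
    also have "0 \<le> \<dots>"
    proof (cases "s $ 0 = 0")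
      case True
      then have "?N = 0" using N by (simp add: sum_nonneg antisym)
      then have "s $ a = 0" if "a \<in> {1..<n}" for a
        using that by (subst (asm) sum_nonneg_eq_0_iff) auto
      then show ?thesis using True by simp
    next
      case False
      then have pos: "0 < s $ 0" using s0 by simp
      \<comment> \<open>Completing the square leaves a multiple of the squared first coordinate
        whose numerator is \<open>(s $ 0)\<^sup>2 - ?N\<close>; this is where the cone condition
        \<open>N\<close> enters.\<close>
      have "(f 0)\<^sup>2 * (s $ 0 - ?N / (2 * s $ 0)) + f 0 * ?X + ?X\<^sup>2 / (2 * s $ 0)
        = ((f 0)\<^sup>2 * ((s $ 0)\<^sup>2 - ?N) + (s $ 0 * f 0 + ?X)\<^sup>2) / (2 * s $ 0)"
        using pos by (simp add: field_simps power2_eq_square)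
      then show ?thesis using N pos by simp
    qed
    finally show ?thesis .
  qed
  then show ?thesis using car by (auto simp: psd_mat_iff cone_lift_def mult_ac)
qed

section \<open>The primal problems\<close>

lemma trace_mat_mult:
  assumes "A \<in> carrier_mat k k" "B \<in> carrier_mat k k"
  shows "trace_mat (A * B) = (\<Sum>p<k. \<Sum>q<k. A $$ (p, q) * B $$ (q, p))"
  using assms by (simp add: trace_mat_def scalar_prod_def lessThan_atLeast0)

lemma sdo_data_mat_carrier:
  assumes "length cs = length ns" "\<forall>i<length ns. cs ! i \<in> carrier_vec (ns ! i)"
  shows "sdo_data_mat cs \<in> carrier_mat (sum_list ns) (sum_list ns)"
  unfolding sdo_data_mat_def using assms by (intro DArw_carrier) auto

lemma index_sdo_data_mat:
  assumes "length cs = length ns" "\<forall>i<length ns. cs ! i \<in> carrier_vec (ns ! i)"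
    and "i < length ns" "a < ns ! i" "j < length ns" "b < ns ! j"
  shows "sdo_data_mat cs $$ (blk ns i + a, blk ns j + b) =
    (if i \<noteq> j then 0 else if a = b then cs ! i $ 0 / real (ns ! i) else if a = 0 then cs ! i $ b / 2
     else if b = 0 then cs ! i $ a / 2 else 0)"
proof -
  have dim: "dim_vec (cs ! k) = ns ! k" if "k < length ns" for k
    using that assms(2) by (metis carrier_vecD)
  show ?thesis
    unfolding sdo_data_mat_def using assms(1,3-)
    by (subst index_DArw[of _ ns]) (simp_all add: dim, clarsimp)
qed

text \<open>The scalings in \<open>sdo_data_mat\<close> are made for this: the first component
  appears \<open>ns ! i\<close> times on the diagonal of an arrow block, every other one twice. Both
  the objective and the linear constraints follow from it.\<close>

lemma trace_sdo_data_mat_DArw: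
  assumes pos: "\<forall>i<length ns. ns ! i \<ge> 1"
    and cs: "length cs = length ns" "\<forall>i<length ns. cs ! i \<in> carrier_vec (ns ! i)"
    and xs: "length xs = length ns" "\<forall>i<length ns. xs ! i \<in> carrier_vec (ns ! i)"
  shows "trace_mat (sdo_data_mat cs * DArw xs) = (\<Sum>i<length ns. cs ! i \<bullet> xs ! i)"
proof -
  let ?D = "sdo_data_mat cs" and ?X = "DArw xs"
  note idx = index_sdo_data_mat[OF cs] index_DArw[OF xs]
  have "trace_mat (?D * ?X) = (\<Sum>i<length ns. \<Sum>a<ns ! i. \<Sum>q<sum_list ns.
      ?D $$ (blk ns i + a, q) * ?X $$ (q, blk ns i + a))"
    by (simp add: trace_mat_mult[OF sdo_data_mat_carrier[OF cs] DArw_carrier[OF xs]] sum_blocks)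
  also have "\<dots> = (\<Sum>i<length ns. \<Sum>a<ns ! i. \<Sum>b<ns ! i.
      ?D $$ (blk ns i + a, blk ns i + b) * ?X $$ (blk ns i + b, blk ns i + a))"
    by (intro sum.cong refl sum_single_block) (auto simp: idx)
  also have "\<dots> = (\<Sum>i<length ns. cs ! i \<bullet> xs ! i)"
  proof (rule sum.cong[OF refl])
    fix i assume "i \<in> {..<length ns}"
    then have i: "i < length ns" and n: "1 \<le> ns ! i" using pos by auto
    have row0: "?D $$ (blk ns i + 0, blk ns i + a) * ?X $$ (blk ns i + a, blk ns i + 0)
            + ?D $$ (blk ns i + a, blk ns i + 0) * ?X $$ (blk ns i + 0, blk ns i + a)
         = cs ! i $ a * xs ! i $ a" if "a \<in> {1..<ns ! i}" for a
    proof -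
      have eqs: "?D $$ (blk ns i, blk ns i + a) = cs ! i $ a / 2" "?D $$ (blk ns i + a, blk ns i) = cs ! i $ a / 2"
        "?X $$ (blk ns i, blk ns i + a) = xs ! i $ a" "?X $$ (blk ns i + a, blk ns i) = xs ! i $ a"
        using that n idx(1)[OF i _ i, of 0 a] idx(1)[OF i _ i, of a 0]
          idx(2)[OF i _ i, of 0 a] idx(2)[OF i _ i, of a 0] by simp_all
      show ?thesis unfolding add_0_right eqs by simp
    qed
    have "(\<Sum>a<ns ! i. \<Sum>b<ns ! i.
        ?D $$ (blk ns i + a, blk ns i + b) * ?X $$ (blk ns i + b, blk ns i + a))
      = (\<Sum>a<ns ! i. ?D $$ (blk ns i + a, blk ns i + a) * ?X $$ (blk ns i + a, blk ns i + a))
        + (\<Sum>a\<in>{1..<ns ! i}. ?D $$ (blk ns i + 0, blk ns i + a) * ?X $$ (blk ns i + a, blk ns i + 0)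
            + ?D $$ (blk ns i + a, blk ns i + 0) * ?X $$ (blk ns i + 0, blk ns i + a))"
      using i n by (intro sum_arrow) (auto simp: idx)
    also have "\<dots> = (\<Sum>a<ns ! i. cs ! i $ 0 / real (ns ! i) * xs ! i $ 0)
        + (\<Sum>a\<in>{1..<ns ! i}. cs ! i $ a * xs ! i $ a)"
      using i by (intro arg_cong2[of _ _ _ _ "(+)"] sum.cong refl row0) (auto simp: idx)
    also have "\<dots> = cs ! i \<bullet> xs ! i"
      using n xs(2)[rule_format, OF i]
      by (simp add: scalar_prod_def lessThan_atLeast0[symmetric] sum_lessThan_split_first)
    finally show "(\<Sum>a<ns ! i. \<Sum>b<ns ! i.
        ?D $$ (blk ns i + a, blk ns i + b) * ?X $$ (blk ns i + b, blk ns i + a)) = cs ! i \<bullet> xs ! i" .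
  qed
  finally show ?thesis .
qed

lemma sum_sum_delta:
  assumes "h < k" "l < (k::nat)"
  shows "(\<Sum>p<k. \<Sum>q<k. if p = h \<and> q = l then g p q else 0) = (g h l :: 'a::comm_monoid_add)"
proof -
  have "(\<Sum>p<k. \<Sum>q<k. if p = h \<and> q = l then g p q else 0) = (\<Sum>p<k. if p = h then g h l else 0)"
    using assms by (intro sum.cong refl) auto
  then show ?thesis using assms by simp
qed

text \<open>Both mirror entries stay separate because \<open>X\<close> need not be symmetric here;
  they are merged in \<open>DArw_first_cols\<close>.\<close>

lemma trace_sdo_A_check:
  assumes "X \<in> carrier_mat (sum_list ns) (sum_list ns)" "h < l" "l < sum_list ns"
  shows "trace_mat (sdo_A_check ns (h, l) * X) = X $$ (l, h) + X $$ (h, l)"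
proof -
  \<comment> \<open>The two nonzero positions differ because \<open>h < l\<close>, so the
    disjunction in \<open>sdo_A_check\<close> may be written as a sum.\<close>
  have "trace_mat (sdo_A_check ns (h, l) * X) = (\<Sum>p<sum_list ns. \<Sum>q<sum_list ns.
      (if p = h \<and> q = l then X $$ (q, p) else 0) + (if p = l \<and> q = h then X $$ (q, p) else 0))"
    using assms(2,3)
    by (subst trace_mat_mult[OF _ assms(1)]) (auto simp: sdo_A_check_def intro!: sum.cong)
  then show ?thesis using assms by (simp add: sum.distrib sum_sum_delta)
qed

lemma trace_sdo_A_hat:
  assumes "X \<in> carrier_mat (sum_list ns) (sum_list ns)" "i < length ns" "0 < a" "a < ns ! i"
  shows "trace_mat (sdo_A_hat ns (blk ns i + a) * X)
    = X $$ (blk ns i, blk ns i) - X $$ (blk ns i + a, blk ns i + a)"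
proof -
  have less: "blk ns i + a < sum_list ns" using assms by (simp add: blk_add_less)
  have "trace_mat (sdo_A_hat ns (blk ns i + a) * X) = (\<Sum>p<sum_list ns. \<Sum>q<sum_list ns.
      (if p = blk ns i \<and> q = blk ns i then X $$ (q, p) else 0)
      - (if p = blk ns i + a \<and> q = blk ns i + a then X $$ (q, p) else 0))"
    using assms(2-) less
    by (subst trace_mat_mult[OF _ assms(1)]) (auto simp: sdo_A_hat_def Cf_blk_add intro!: sum.cong)
  then show ?thesis using less by (simp add: sum_subtractf sum_sum_delta)
qed

section \<open>Recovering vectors from arrow matrices\<close>

text \<open>The primal component of \<open>map_M_inv\<close>, isolated so that it can be shown to
  invert \<open>DArw\<close>.\<close>

definition first_cols :: "nat list \<Rightarrow> real mat \<Rightarrow> real vec list" where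
  "first_cols ns X = map (\<lambda>i. vec (ns ! i) (\<lambda>j. X $$ (blk ns i + j, blk ns i))) [0..<length ns]"

lemma first_cols_DArw:
  assumes "\<forall>i<length ns. ns ! i \<ge> 1"
    and "length xs = length ns" "\<forall>i<length ns. xs ! i \<in> carrier_vec (ns ! i)"
  shows "first_cols ns (DArw xs) = xs"
proof (rule nth_equalityI)
  fix i assume "i < length (first_cols ns (DArw xs))"
  then have i: "i < length ns" by (simp add: first_cols_def)
  have dim: "dim_vec (xs ! i) = ns ! i" using i assms(3) by (metis carrier_vecD)
  show "first_cols ns (DArw xs) ! i = xs ! i"
  proof (rule eq_vecI)
    fix j assume "j < dim_vec (xs ! i)"
    then have j: "j < ns ! i" "0 < ns ! i" by (auto simp: dim)
    have "DArw xs $$ (blk ns i + j, blk ns i) = xs ! i $ j"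
      using index_DArw[OF assms(2,3) i j(1) i j(2)] by simp
    then show "first_cols ns (DArw xs) ! i $ j = xs ! i $ j"
      using i j by (simp add: first_cols_def)
  qed (use i dim in \<open>simp add: first_cols_def\<close>)
qed (simp add: first_cols_def assms(2))

text \<open>The easy half of the characterisation of block diagonal arrow matrices by
  \<open>idxI\<close> and \<open>idxK\<close>; \<open>DArw_first_cols\<close> is the
  converse.\<close>

lemma sdo_constraints_DArw:
  assumes "length xs = length ns" "\<forall>i<length ns. xs ! i \<in> carrier_vec (ns ! i)"
  shows "hl \<in> idxI ns \<Longrightarrow> trace_mat (sdo_A_check ns hl * DArw xs) = 0"
    and "k \<in> idxK ns \<Longrightarrow> trace_mat (sdo_A_hat ns k * DArw xs) = 0"
proof -
  note idx = index_DArw[OF assms] and car = DArw_carrier[OF assms]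
  assume "hl \<in> idxI ns"
  then obtain h l where hl: "hl = (h, l)" "(h, l) \<in> idxI ns" by (cases hl) auto
  then have less: "h < l" "l < sum_list ns" "h < sum_list ns" by (auto simp: idxI_def)
  obtain i a where i: "i < length ns" "a < ns ! i" "h = blk ns i + a"
    using less(3) by (rule block_index_obtain)
  obtain j b where j: "j < length ns" "b < ns ! j" "l = blk ns j + b"
    using less(2) by (rule block_index_obtain)
  have "i < j \<or> (i = j \<and> 0 < a \<and> a < b)" using hl i j idxI_blk_iff by blast
  then show "trace_mat (sdo_A_check ns hl * DArw xs) = 0"
    unfolding hl trace_sdo_A_check[OF car less(1,2)] using i j by (auto simp: idx)
next
  note idx = index_DArw[OF assms] and car = DArw_carrier[OF assms]
  assume k: "k \<in> idxK ns"
  then have "k < sum_list ns" by (simp add: idxK_def)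
  then obtain i a where i: "i < length ns" "a < ns ! i" "k = blk ns i + a"
    by (rule block_index_obtain)
  with k have a: "0 < a" using idxK_blk_iff by blast
  show "trace_mat (sdo_A_hat ns k * DArw xs) = 0"
    unfolding i(3) trace_sdo_A_hat[OF car i(1) a i(2)]
    using idx[OF i(1,2) i(1,2)] idx[OF i(1) _ i(1), of 0 0] a i(2) by simp
qed

text \<open>By symmetry a constraint from \<open>idxI\<close> says that twice an entry is zero,
  which kills it and its mirror image. A constraint from \<open>idxK\<close> equates a diagonal
  entry with the corner of its block. The first columns of the blocks determine the rest.\<close>

lemma DArw_first_cols:
  assumes X: "sym_mat (sum_list ns) X"
    and chk: "\<forall>hl \<in> idxI ns. trace_mat (sdo_A_check ns hl * X) = 0"
    and hat: "\<forall>k \<in> idxK ns. trace_mat (sdo_A_hat ns k * X) = 0"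
  shows "X = DArw (first_cols ns X)"
proof (rule mat_eq_blocksI)
  have car: "X \<in> carrier_mat (sum_list ns) (sum_list ns)"
    and sym: "\<And>p q. p < sum_list ns \<Longrightarrow> q < sum_list ns \<Longrightarrow> X $$ (p, q) = X $$ (q, p)"
    using X by (auto simp: sym_mat_iff)
  have fc: "length (first_cols ns X) = length ns"
    "\<forall>i<length ns. first_cols ns X ! i \<in> carrier_vec (ns ! i)"
    by (auto simp: first_cols_def)
  show "X \<in> carrier_mat (sum_list ns) (sum_list ns)" by (rule car)
  show "DArw (first_cols ns X) \<in> carrier_mat (sum_list ns) (sum_list ns)" by (rule DArw_carrier[OF fc])
  have I0: "X $$ (h, l) = 0 \<and> X $$ (l, h) = 0" if "(h, l) \<in> idxI ns" for h l
  proof -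
    have "h < l" "l < sum_list ns" using that by (auto simp: idxI_def)
    then show ?thesis using chk that trace_sdo_A_check[OF car, of h l] sym[of h l] by fastforce
  qed
  have K0: "X $$ (blk ns i + a, blk ns i + a) = X $$ (blk ns i, blk ns i)"
    if "i < length ns" "0 < a" "a < ns ! i" for i a
    using trace_sdo_A_hat[OF car that] hat idxK_blk_iff[of i ns a] that by auto
  fix i a j b assume ij: "i < length ns" "a < ns ! i" "j < length ns" "b < ns ! j"
  have sy: "X $$ (blk ns i, blk ns i + b) = X $$ (blk ns i + b, blk ns i)" if "i = j"
    using ij that blk_add_less[of i ns 0] blk_add_less[of i ns b] by (intro sym) auto
  have off: "X $$ (blk ns i + a, blk ns j + b) = 0" if "i \<noteq> j \<or> (0 < a \<and> 0 < b \<and> a \<noteq> b)"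
  proof -
    have "(blk ns i + a, blk ns j + b) \<in> idxI ns \<or> (blk ns j + b, blk ns i + a) \<in> idxI ns"
      using that ij by (auto simp: idxI_blk_iff)
    then show ?thesis using I0 by blast
  qed
  show "X $$ (blk ns i + a, blk ns j + b) = DArw (first_cols ns X) $$ (blk ns i + a, blk ns j + b)"
    using ij off sy K0[of i a]
    by (subst index_DArw[OF fc ij]) (cases "a = 0"; cases "b = 0"; auto simp: first_cols_def)
qed

text \<open>Principal submatrices give one direction and block diagonal assembly the other;
  \<open>psd_Arw_iff\<close> translates each block.\<close>

lemma psd_DArw_iff:
  assumes pos: "\<forall>i<length ns. ns ! i \<ge> 1"
    and xs: "length xs = length ns" "\<forall>i<length ns. xs ! i \<in> carrier_vec (ns ! i)"
  shows "psd_mat (sum_list ns) (DArw xs) \<longleftrightarrow> (\<forall>i<length ns. xs ! i \<in> lorentz_cone (ns ! i))"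
proof
  assume psd: "psd_mat (sum_list ns) (DArw xs)"
  show "\<forall>i<length ns. xs ! i \<in> lorentz_cone (ns ! i)"
  proof (intro allI impI)
    fix i assume i: "i < length ns"
    have "mat (ns ! i) (ns ! i) (\<lambda>(a, b). DArw xs $$ (blk ns i + a, blk ns i + b)) = Arw (xs ! i)"
      (is "?B = _")
    proof (rule eq_matI)
      have dim: "dim_vec (xs ! i) = ns ! i" using i xs(2) by (metis carrier_vecD)
      show "?B $$ (a, b) = Arw (xs ! i) $$ (a, b)" if "a < dim_row (Arw (xs ! i))" "b < dim_col (Arw (xs ! i))" for a b
        using that i by (simp add: Arw_def dim index_DArw[OF xs])
      show "dim_row ?B = dim_row (Arw (xs ! i))" "dim_col ?B = dim_col (Arw (xs ! i))"
        by (simp_all add: Arw_def dim)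
    qed
    then show "xs ! i \<in> lorentz_cone (ns ! i)"
      using psd_diag_block[OF psd i] psd_Arw_iff[of "xs ! i" "ns ! i"] i xs pos by simp
  qed
next
  assume L: "\<forall>i<length ns. xs ! i \<in> lorentz_cone (ns ! i)"
  have "psd_mat (ns ! i) (Arw (xs ! i))" if "i < length ns" for i
    using psd_Arw_iff[of "xs ! i" "ns ! i"] that L xs(2) pos by blast
  then show "psd_mat (sum_list ns) (DArw xs)"
    unfolding DArw_def using xs(1) by (intro psd_diag_block_mat) simp_all
qed

text \<open>Splits the vector equation into coordinates, to be matched with the trace constraints
  one by one.\<close>

lemma soco_primal_eq_iff:
  assumes "\<forall>i<length ns. A ! i \<in> carrier_mat m (ns ! i)"
    and "\<forall>i<length ns. xs ! i \<in> carrier_vec (ns ! i)" and "b \<in> carrier_vec m"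
  shows "finsum_vec TYPE(real) m (\<lambda>i. A ! i *\<^sub>v xs ! i) {..<length ns} = b
    \<longleftrightarrow> (\<forall>j<m. (\<Sum>i<length ns. row (A ! i) j \<bullet> xs ! i) = b $ j)"
proof -
  let ?f = "finsum_vec TYPE(real) m (\<lambda>i. A ! i *\<^sub>v xs ! i) {..<length ns}"
  have f: "(\<lambda>i. A ! i *\<^sub>v xs ! i) \<in> {..<length ns} \<rightarrow> carrier_vec m"
    using assms by (auto intro!: mult_mat_vec_carrier)
  have "?f \<in> carrier_vec m" by (rule finsum_vec_closed[OF f])
  then have "?f = b \<longleftrightarrow> (\<forall>j<m. ?f $ j = b $ j)" using assms(3) by (auto simp: vec_eq_iff)
  moreover have "?f $ j = (\<Sum>i<length ns. row (A ! i) j \<bullet> xs ! i)" if "j < m" for j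
    unfolding index_finsum_vec[OF finite_lessThan that f]
    using assms(1) that by (intro sum.cong refl) auto
  ultimately show ?thesis by auto
qed

text \<open>Settles the primal half of both mappings at once: \<open>map_M\<close> applies
  \<open>DArw\<close>, and every feasible \<open>X\<close> has the form to which
  \<open>first_cols\<close> is inverse.\<close>

lemma sdo_primal_feasible_eq_image:
  assumes pos: "\<forall>i<length ns. ns ! i \<ge> 1"
    and A: "length A = length ns" "\<forall>i<length ns. A ! i \<in> carrier_mat m (ns ! i)"
    and b: "b \<in> carrier_vec m"
  shows "sdo_primal_feasible ns m A b = DArw ` soco_primal_feasible ns m A b"
proof -
  have rows: "\<forall>i<length ns. map (\<lambda>Ai. row Ai j) A ! i \<in> carrier_vec (ns ! i)" for j
  proof (intro allI impI)
    fix i assume i: "i < length ns"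
    then have "dim_col (A ! i) = ns ! i" using A(2) by (metis carrier_matD(2))
    then show "map (\<lambda>Ai. row Ai j) A ! i \<in> carrier_vec (ns ! i)" 
      using i A(1) by (intro carrier_vecI) simp
  qed
  have "DArw xs \<in> sdo_primal_feasible ns m A b \<longleftrightarrow> xs \<in> soco_primal_feasible ns m A b"
    if xs: "length xs = length ns" "\<forall>i<length ns. xs ! i \<in> carrier_vec (ns ! i)" for xs
  proof -
    have "trace_mat (sdo_A A j * DArw xs) = (\<Sum>i<length ns. row (A ! i) j \<bullet> xs ! i)" for j
      unfolding sdo_A_def using A(1) by (subst trace_sdo_data_mat_DArw[OF pos _ rows xs]) simp_all
    then show ?thesis
      unfolding sdo_primal_feasible_def soco_primal_feasible_def mem_Collect_eq
      using xs(1) by (simp add: sdo_constraints_DArw[OF xs] psd_DArw_iff[OF pos xs]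
          soco_primal_eq_iff[OF A(2) xs(2) b])
  qed
  note iff = this
  show ?thesis
  proof (intro equalityI subsetI)
    fix X assume X: "X \<in> sdo_primal_feasible ns m A b"
    then have "X = DArw (first_cols ns X)"
      by (intro DArw_first_cols) (auto simp: sdo_primal_feasible_def psd_mat_def)
    moreover have "first_cols ns X \<in> soco_primal_feasible ns m A b"
      \<comment> \<open>Through \<open>iff\<close>, membership of \<open>first_cols ns X\<close>
        becomes membership of its image under \<open>DArw\<close>, which is \<open>X\<close>
        itself.\<close>
      using X calculation by (subst iff[symmetric]) (auto simp: first_cols_def)
    ultimately show "X \<in> DArw ` soco_primal_feasible ns m A b" by blast
  next
    fix X assume "X \<in> DArw ` soco_primal_feasible ns m A b"
    then obtain xs where xs: "xs \<in> soco_primal_feasible ns m A b" "X = DArw xs" by blast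
    then have "length xs = length ns" "\<forall>i<length ns. xs ! i \<in> carrier_vec (ns ! i)"
      by (auto simp: soco_primal_feasible_def lorentz_cone_def)
    then show "X \<in> sdo_primal_feasible ns m A b" using iff xs by blast
  qed
qed

section \<open>The dual problems\<close>

lemma lincomb_mat_carrier [simp]: "lincomb_mat k a F I \<in> carrier_mat k k"
  by (simp add: lincomb_mat_def)

lemma index_lincomb_mat:
  "p < k \<Longrightarrow> q < k \<Longrightarrow> lincomb_mat k a F I $$ (p, q) = (\<Sum>i\<in>I. a i * F i $$ (p, q))"
  by (simp add: lincomb_mat_def)

text \<open>\<open>sdo_data_mat\<close> is linear in its data, so combining the rows of the
  \<open>A ! i\<close> with weights \<open>y\<close> amounts to forming the transposed products
  first. The result has the same shape as \<open>sdo_C c\<close> and can be compared with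
  it.\<close>

lemma lincomb_sdo_A:
  assumes A: "length A = length ns" "\<forall>i<length ns. A ! i \<in> carrier_mat m (ns ! i)"
    and y: "y \<in> carrier_vec m"
  shows "lincomb_mat (sum_list ns) (\<lambda>j. y $ j) (sdo_A A) {..<m}
    = sdo_data_mat (map (\<lambda>Ai. transpose_mat Ai *\<^sub>v y) A)"
proof -
  have Ai: "dim_row (A ! i) = m" "dim_col (A ! i) = ns ! i" if "i < length ns" for i
    using that A(2) by (metis carrier_matD)+
  have rows: "length (map (\<lambda>Ai. row Ai j) A) = length ns"
    "\<forall>i<length ns. map (\<lambda>Ai. row Ai j) A ! i \<in> carrier_vec (ns ! i)" for j
    using A(1) by (auto intro!: carrier_vecI simp: Ai)
  have cols: "length (map (\<lambda>Ai. transpose_mat Ai *\<^sub>v y) A) = length ns"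
    "\<forall>i<length ns. map (\<lambda>Ai. transpose_mat Ai *\<^sub>v y) A ! i \<in> carrier_vec (ns ! i)"
    using A(1) by (auto intro!: carrier_vecI simp: Ai)
  have At: "(transpose_mat (A ! i) *\<^sub>v y) $ l = (\<Sum>k<m. y $ k * A ! i $$ (k, l))"
    if "i < length ns" "l < ns ! i" for i l
    using that y by (simp add: Ai scalar_prod_def lessThan_atLeast0 mult.commute)
  show ?thesis
  proof (rule mat_eq_blocksI[OF lincomb_mat_carrier sdo_data_mat_carrier[OF cols]])
    fix i a j b assume ij: "i < length ns" "a < ns ! i" "j < length ns" "b < ns ! j"
    have "lincomb_mat (sum_list ns) (\<lambda>j. y $ j) (sdo_A A) {..<m} $$ (blk ns i + a, blk ns j + b)
      = (\<Sum>k<m. y $ k * (if i \<noteq> j then 0 else if a = b then A ! i $$ (k, 0) / real (ns ! i)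
          else if a = 0 then A ! i $$ (k, b) / 2 else if b = 0 then A ! i $$ (k, a) / 2 else 0))"
      unfolding index_lincomb_mat[OF blk_add_less[OF ij(1,2)] blk_add_less[OF ij(3,4)]]
    proof (intro sum.cong refl arg_cong2[of _ _ _ _ "(*)"])
      fix k assume "k \<in> {..<m}"
      then have "k < m" by simp
      then show "sdo_A A k $$ (blk ns i + a, blk ns j + b) = (if i \<noteq> j then 0 else
          if a = b then A ! i $$ (k, 0) / real (ns ! i)
          else if a = 0 then A ! i $$ (k, b) / 2 else if b = 0 then A ! i $$ (k, a) / 2 else 0)"
        unfolding sdo_A_def index_sdo_data_mat[OF rows ij] using ij A(1) by (auto simp: Ai)
    qed
    also have "\<dots> = sdo_data_mat (map (\<lambda>Ai. transpose_mat Ai *\<^sub>v y) A) $$ (blk ns i + a, blk ns j + b)"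
      unfolding index_sdo_data_mat[OF cols ij] using ij A(1)
      by (auto simp: At sum_divide_distrib[symmetric] simp del: index_mult_mat_vec)
    finally show "lincomb_mat (sum_list ns) (\<lambda>j. y $ j) (sdo_A A) {..<m} $$ (blk ns i + a, blk ns j + b)
      = sdo_data_mat (map (\<lambda>Ai. transpose_mat Ai *\<^sub>v y) A) $$ (blk ns i + a, blk ns j + b)" .
  qed
qed

text \<open>Pairs in \<open>idxI\<close> are increasing, so at most one multiplier reaches a given
  entry, either directly or through the mirror position.\<close>

lemma index_lincomb_sdo_A_check:
  assumes "p < sum_list ns" "q < sum_list ns"
  shows "lincomb_mat (sum_list ns) v (sdo_A_check ns) (idxI ns) $$ (p, q)
    = (if (p, q) \<in> idxI ns then v (p, q) else if (q, p) \<in> idxI ns then v (q, p) else 0)"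
proof -
  have "lincomb_mat (sum_list ns) v (sdo_A_check ns) (idxI ns) $$ (p, q)
    = (\<Sum>hl\<in>idxI ns. (if hl = (p, q) then v (p, q) else 0)
        + (if hl = (q, p) then v (q, p) else 0))"
    unfolding index_lincomb_mat[OF assms]
  proof (intro sum.cong refl)
    fix hl assume "hl \<in> idxI ns"
    then obtain h l where hl: "hl = (h, l)" "h < l" by (cases hl) (simp add: idxI_def)
    have "sdo_A_check ns hl $$ (p, q) = (if p = h \<and> q = l \<or> p = l \<and> q = h then 1 else 0)"
      using assms by (simp add: hl(1) sdo_A_check_def)
    then show "v hl * sdo_A_check ns hl $$ (p, q)
      = (if hl = (p, q) then v (p, q) else 0) + (if hl = (q, p) then v (q, p) else 0)"
      using hl by auto
  qed
  also have "\<dots> = (if (p, q) \<in> idxI ns then v (p, q) else 0) + (if (q, p) \<in> idxI ns then v (q, p) else 0)"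
    by (simp add: sum.distrib)
  finally show ?thesis using idxI_asym[of p q ns] by simp
qed

lemma sum_idxK:
  "(\<Sum>k\<in>idxK ns. f k) = (\<Sum>i<length ns. \<Sum>a\<in>{1..<ns ! i}. f (blk ns i + a))"
proof -
  have "(\<Sum>k\<in>idxK ns. f k) = (\<Sum>k<sum_list ns. if k \<in> idxK ns then f k else 0)"
    by (rule sum.mono_neutral_cong_left) (auto simp: idxK_def)
  also have "\<dots> = (\<Sum>i<length ns. \<Sum>a<ns ! i. if 0 < a then f (blk ns i + a) else 0)"
    unfolding sum_blocks by (intro sum.cong refl) (auto simp: idxK_blk_iff)
  also have "\<dots> = (\<Sum>i<length ns. \<Sum>a\<in>{1..<ns ! i}. f (blk ns i + a))"
    by (intro sum.cong refl sum.mono_neutral_cong_right) auto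
  finally show ?thesis .
qed

lemma index_sdo_A_hat:
  assumes "i < length ns" "a < ns ! i" "j < length ns" "b < ns ! j" "k < length ns" "0 < e" "e < ns ! k"
  shows "sdo_A_hat ns (blk ns k + e) $$ (blk ns i + a, blk ns j + b) =
    (if i = k \<and> j = k \<and> a = b then if a = e then - 1 else if a = 0 then 1 else 0 else 0)"
proof -
  have "blk ns i + a = blk ns k + e \<longleftrightarrow> i = k \<and> a = e"
    "blk ns j + b = blk ns k + e \<longleftrightarrow> j = k \<and> b = e"
    "blk ns i + a = blk ns k \<longleftrightarrow> i = k \<and> a = 0"
    "blk ns j + b = blk ns k \<longleftrightarrow> j = k \<and> b = 0"
    using assms blk_add_inj[of a ns i e k] blk_add_inj[of b ns j e k]
      blk_add_inj[of a ns i 0 k] blk_add_inj[of b ns j 0 k] by auto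
  then show ?thesis
    using assms(5-) blk_add_less[OF assms(1,2)] blk_add_less[OF assms(3,4)]
    by (auto simp: sdo_A_hat_def Cf_blk_add)
qed

text \<open>After grouping by blocks only block \<open>i\<close> contributes. Its corner is touched
  by every \<open>sdo_A_hat\<close> of the block, any other diagonal position by exactly
  one.\<close>

lemma index_lincomb_sdo_A_hat:
  assumes ij: "i < length ns" "a < ns ! i" "j < length ns" "b < ns ! j"
  shows "lincomb_mat (sum_list ns) z (sdo_A_hat ns) (idxK ns) $$ (blk ns i + a, blk ns j + b)
    = (if i = j \<and> a = b then if a = 0 then \<Sum>e\<in>{1..<ns ! i}. z (blk ns i + e) else - z (blk ns i + a)
       else 0)" (is "_ = ?r")
proof -
  have "lincomb_mat (sum_list ns) z (sdo_A_hat ns) (idxK ns) $$ (blk ns i + a, blk ns j + b)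
    = (\<Sum>k<length ns. \<Sum>e\<in>{1..<ns ! k}. z (blk ns k + e) *
        sdo_A_hat ns (blk ns k + e) $$ (blk ns i + a, blk ns j + b))"
    unfolding index_lincomb_mat[OF blk_add_less[OF ij(1,2)] blk_add_less[OF ij(3,4)]] by (rule sum_idxK)
  also have "\<dots> = (\<Sum>k<length ns. if k = i then ?r else 0)"
  proof (intro sum.cong refl)
    fix k assume "k \<in> {..<length ns}"
    then have k: "k < length ns" by simp
    have "(\<Sum>e\<in>{1..<ns ! k}. z (blk ns k + e) *
        sdo_A_hat ns (blk ns k + e) $$ (blk ns i + a, blk ns j + b))
      = (\<Sum>e\<in>{1..<ns ! k}. if i = k \<and> j = k \<and> a = b then
          if a = 0 then z (blk ns k + e) else if a = e then - z (blk ns k + e) else 0 else 0)"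
      using ij k by (intro sum.cong refl) (auto simp: index_sdo_A_hat)
    also have "\<dots> = (if k = i then ?r else 0)" using ij(2) by auto
    finally show "(\<Sum>e\<in>{1..<ns ! k}. z (blk ns k + e) *
        sdo_A_hat ns (blk ns k + e) $$ (blk ns i + a, blk ns j + b)) = (if k = i then ?r else 0)" .
  qed
  also have "\<dots> = ?r" using ij(1) by simp
  finally show ?thesis .
qed

text \<open>
  The condition on the trace of block \<open>i\<close> comes from the entry at its upper left corner after the
  multipliers \<open>z\<close> have been eliminated by means of the remaining diagonal entries.
\<close>

lemma sdo_dual_eq_iff:
  assumes pos: "\<forall>i<length ns. ns ! i \<ge> 1"
    and A: "length A = length ns" "\<forall>i<length ns. A ! i \<in> carrier_mat m (ns ! i)"
    and c: "length c = length ns" "\<forall>i<length ns. c ! i \<in> carrier_vec (ns ! i)"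
    and y: "y \<in> carrier_vec m" and S: "sym_mat (sum_list ns) S"
  shows "sdo_dual_eq ns m A c y v z S \<longleftrightarrow>
    (\<forall>(h, l) \<in> idxI ns. v (h, l) = - S $$ (h, l)) \<and>
    (\<forall>i<length ns. let d = transpose_mat (A ! i) *\<^sub>v y; n = ns ! i; u = blk ns i in
       (\<forall>a\<in>{1..<n}. d $ a + 2 * S $$ (u, u + a) = c ! i $ a) \<and>
       (\<forall>a\<in>{1..<n}. z (u + a) = (d $ 0 - c ! i $ 0) / n + S $$ (u + a, u + a)) \<and>
       d $ 0 + (\<Sum>a<n. S $$ (u + a, u + a)) = c ! i $ 0)"
proof -
  define ds where "ds = map (\<lambda>Ai. transpose_mat Ai *\<^sub>v y) A"
  have Ai: "dim_row (A ! i) = m" "dim_col (A ! i) = ns ! i" if "i < length ns" for i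
    using that A(2) by (metis carrier_matD)+
  have ds: "length ds = length ns" "\<forall>i<length ns. ds ! i \<in> carrier_vec (ns ! i)"
    using A(1) by (auto intro!: carrier_vecI simp: Ai ds_def)
  have d: "transpose_mat (A ! i) *\<^sub>v y = ds ! i" if "i < length ns" for i
    using that A(1) by (simp add: ds_def)
  have S_car: "S \<in> carrier_mat (sum_list ns) (sum_list ns)"
    and S_sym: "\<And>p q. p < sum_list ns \<Longrightarrow> q < sum_list ns \<Longrightarrow> S $$ (p, q) = S $$ (q, p)"
    using S by (auto simp: sym_mat_iff)
  let ?N = "sum_list ns"
  let ?V = "lincomb_mat ?N v (sdo_A_check ns) (idxI ns)"
  let ?Z = "lincomb_mat ?N z (sdo_A_hat ns) (idxK ns)"
  let ?E = "\<lambda>p q. sdo_data_mat ds $$ (p, q) + ?V $$ (p, q) + ?Z $$ (p, q) + S $$ (p, q)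
    = sdo_data_mat c $$ (p, q)"
  note car = sdo_data_mat_carrier[OF ds] sdo_data_mat_carrier[OF c] S_car
  note idx = index_sdo_data_mat[OF ds] index_sdo_data_mat[OF c] index_lincomb_sdo_A_hat
    index_lincomb_sdo_A_check[OF blk_add_less blk_add_less] idxI_blk_iff
  have eq: "sdo_dual_eq ns m A c y v z S \<longleftrightarrow> (\<forall>p<?N. \<forall>q<?N. ?E p q)"
    unfolding sdo_dual_eq_def lincomb_sdo_A[OF A y] ds_def[symmetric] sdo_C_def
    using car by (auto simp: mat_eq_iff lincomb_mat_def add.assoc)
  \<comment> \<open>Off the arrow the data matrices and \<open>?Z\<close> vanish, so
    \<open>v\<close> alone balances the entry of \<open>S\<close>.\<close>
  have off: "?E (blk ns i + a) (blk ns j + b) \<longleftrightarrow>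
      v (blk ns i + a, blk ns j + b) = - S $$ (blk ns i + a, blk ns j + b)"
    if "i < length ns" "a < ns ! i" "j < length ns" "b < ns ! j" "i < j \<or> i = j \<and> 0 < a \<and> a < b"
    for i a j b
    using that by (auto simp: idx)
  \<comment> \<open>On the arrow \<open>?V\<close> and \<open>?Z\<close> vanish, and the factor 1/2
    of the data becomes a factor 2 at \<open>S\<close>. The index facts are instantiated at offset 0
    because the position is written \<open>blk ns i\<close>, not
    \<open>blk ns i + 0\<close>.\<close>
  have row0: "?E (blk ns i) (blk ns i + a) \<longleftrightarrow> ds ! i $ a + 2 * S $$ (blk ns i, blk ns i + a) = c ! i $ a"
    if "i < length ns" "0 < a" "a < ns ! i" for i a
    using that idx(1)[of i 0 i a] idx(2)[of i 0 i a] idx(3)[of i ns 0 i a]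
      idx(4)[of i ns 0 i a v] idxI_blk_iff[of i ns 0 i a] idxI_blk_iff[of i ns a i 0] by auto
  have diag: "?E (blk ns i + a) (blk ns i + a) \<longleftrightarrow>
      z (blk ns i + a) = (ds ! i $ 0 - c ! i $ 0) / ns ! i + S $$ (blk ns i + a, blk ns i + a)"
    if "i < length ns" "0 < a" "a < ns ! i" for i a
    using that by (auto simp: idx diff_divide_distrib)
  have corner: "?E (blk ns i) (blk ns i) \<longleftrightarrow> ds ! i $ 0 / ns ! i + (\<Sum>a\<in>{1..<ns ! i}. z (blk ns i + a))
      + S $$ (blk ns i, blk ns i) = c ! i $ 0 / ns ! i"
    if "i < length ns" "0 < ns ! i" for i
    using that idx(1)[of i 0 i 0] idx(2)[of i 0 i 0] idx(3)[of i ns 0 i 0]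
      idx(4)[of i ns 0 i 0 v] idxI_blk_iff[of i ns 0 i 0] by auto
  have tr: "ds ! i $ 0 / ns ! i + (\<Sum>a\<in>{1..<ns ! i}. z (blk ns i + a))
      + S $$ (blk ns i, blk ns i) = c ! i $ 0 / ns ! i
    \<longleftrightarrow> ds ! i $ 0 + (\<Sum>a<ns ! i. S $$ (blk ns i + a, blk ns i + a)) = c ! i $ 0"
    if i: "i < length ns" and z: "\<forall>a\<in>{1..<ns ! i}. z (blk ns i + a) =
      (ds ! i $ 0 - c ! i $ 0) / ns ! i + S $$ (blk ns i + a, blk ns i + a)" for i
  proof -
    have n: "1 \<le> ns ! i" using pos i by blast
    have "(\<Sum>a\<in>{1..<ns ! i}. z (blk ns i + a)) = real (ns ! i - 1) * ((ds ! i $ 0 - c ! i $ 0) / ns ! i)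
       + (\<Sum>a\<in>{1..<ns ! i}. S $$ (blk ns i + a, blk ns i + a))"
      using z by (simp add: sum.distrib)
    \<comment> \<open>The \<open>ns ! i - 1\<close> copies of the quotient and the one already
      present at the corner add up to \<open>ds ! i $ 0 - c ! i $ 0\<close>, which removes the
      division.\<close>
    also have "real (ns ! i - 1) * ((ds ! i $ 0 - c ! i $ 0) / ns ! i)
      = (ds ! i $ 0 - c ! i $ 0) - (ds ! i $ 0 / ns ! i - c ! i $ 0 / ns ! i)"
      using n by (simp add: of_nat_diff field_simps)
    finally show ?thesis by (auto simp: sum_lessThan_split_first[OF n])
  qed
  have tr_E: "?E (blk ns i) (blk ns i) \<longleftrightarrow>
      ds ! i $ 0 + (\<Sum>a<ns ! i. S $$ (blk ns i + a, blk ns i + a)) = c ! i $ 0"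
    if "i < length ns" and "\<forall>a\<in>{1..<ns ! i}. z (blk ns i + a) =
      (ds ! i $ 0 - c ! i $ 0) / ns ! i + S $$ (blk ns i + a, blk ns i + a)" for i
    unfolding tr[OF that, symmetric] by (rule corner) (use that pos in \<open>auto simp: Suc_le_eq\<close>)
  \<comment> \<open>All matrices involved are symmetric, so only positions with
    \<open>p \<le> q\<close> have to be derived from the right-hand side.\<close>
  have E_sym: "?E p q \<longleftrightarrow> ?E q p" if pq: "p < ?N" "q < ?N" for p q
  proof -
    obtain i a where i: "i < length ns" "a < ns ! i" "p = blk ns i + a"
      using pq(1) by (rule block_index_obtain)
    obtain j b where j: "j < length ns" "b < ns ! j" "q = blk ns j + b"
      using pq(2) by (rule block_index_obtain)
    have "sdo_data_mat ds $$ (p, q) = sdo_data_mat ds $$ (q, p)"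
      "sdo_data_mat c $$ (p, q) = sdo_data_mat c $$ (q, p)" "?Z $$ (p, q) = ?Z $$ (q, p)"
      using i j by (auto simp: idx)
    moreover have "?V $$ (p, q) = ?V $$ (q, p)"
      using pq idxI_asym[of p q ns] by (auto simp: index_lincomb_sdo_A_check)
    ultimately show ?thesis using S_sym[OF pq] by simp
  qed
  have "(\<forall>p<?N. \<forall>q<?N. ?E p q) \<longleftrightarrow>
    (\<forall>(h, l) \<in> idxI ns. v (h, l) = - S $$ (h, l)) \<and>
    (\<forall>i<length ns.
       (\<forall>a\<in>{1..<ns ! i}. ds ! i $ a + 2 * S $$ (blk ns i, blk ns i + a) = c ! i $ a) \<and>
       (\<forall>a\<in>{1..<ns ! i}. z (blk ns i + a) =
          (ds ! i $ 0 - c ! i $ 0) / ns ! i + S $$ (blk ns i + a, blk ns i + a)) \<and>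
       ds ! i $ 0 + (\<Sum>a<ns ! i. S $$ (blk ns i + a, blk ns i + a)) = c ! i $ 0)"
    (is "?L \<longleftrightarrow> ?RV \<and> (\<forall>i<length ns. ?R1 i \<and> ?R2 i \<and> ?R3 i)")
  proof
    assume L: ?L
    have E: "?E (blk ns i + a) (blk ns j + b)"
      if "i < length ns" "a < ns ! i" "j < length ns" "b < ns ! j" for i a j b
      using L blk_add_less that by blast
    have ?RV
    proof (clarify)
      fix h l assume hl: "(h, l) \<in> idxI ns"
      then have "h < ?N" "l < ?N" by (auto simp: idxI_def)
      obtain i a where i: "i < length ns" "a < ns ! i" "h = blk ns i + a"
        using \<open>h < ?N\<close> by (rule block_index_obtain)
      obtain j b where j: "j < length ns" "b < ns ! j" "l = blk ns j + b"
        using \<open>l < ?N\<close> by (rule block_index_obtain)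
      show "v (h, l) = - S $$ (h, l)"
        using off[OF i(1,2) j(1,2)] E[OF i(1,2) j(1,2)] hl idxI_blk_iff[OF i(1,2) j(1,2)]
        unfolding i(3) j(3) by blast
    qed
    moreover have "?R1 i \<and> ?R2 i \<and> ?R3 i" if i: "i < length ns" for i
    proof -
      have n: "0 < ns ! i" using pos i by (auto simp: Suc_le_eq)
      have 1: "?R1 i"
      proof
        fix a assume "a \<in> {1..<ns ! i}"
        then have a: "0 < a" "a < ns ! i" by auto
        show "ds ! i $ a + 2 * S $$ (blk ns i, blk ns i + a) = c ! i $ a"
          using row0[OF i a] E[OF i n i a(2)] by simp
      qed
      have 2: "?R2 i"
      proof
        fix a assume "a \<in> {1..<ns ! i}"
        then have a: "0 < a" "a < ns ! i" by auto
        show "z (blk ns i + a) = (ds ! i $ 0 - c ! i $ 0) / ns ! i + S $$ (blk ns i + a, blk ns i + a)"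
          using diag[OF i a] E[OF i a(2) i a(2)] by blast
      qed
      show ?thesis using 1 2 tr_E[OF i 2] E[OF i n i n] by simp
    qed
    ultimately show "?RV \<and> (\<forall>i<length ns. ?R1 i \<and> ?R2 i \<and> ?R3 i)" by blast
  next
    assume R: "?RV \<and> (\<forall>i<length ns. ?R1 i \<and> ?R2 i \<and> ?R3 i)"
    have upper: "?E p q" if pq: "p < ?N" "q < ?N" "p \<le> q" for p q
    proof -
      obtain i a where i: "i < length ns" "a < ns ! i" "p = blk ns i + a"
        using pq(1) by (rule block_index_obtain)
      obtain j b where j: "j < length ns" "b < ns ! j" "q = blk ns j + b"
        using pq(2) by (rule block_index_obtain)
      have R': "?R1 i" "?R2 i" "?R3 i" using R i(1) by blast+
      \<comment> \<open>The positions on or above the diagonal: those in \<open>idxI\<close>, the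
        first row of a block, the diagonal below the corner, and the corner.\<close>
      consider "i < j \<or> i = j \<and> 0 < a \<and> a < b" | "i = j" "a = 0" "0 < b" | "i = j" "a = b" "0 < a"
        | "i = j" "a = 0" "b = 0"
      proof -
        have "i \<le> j"
        proof (rule ccontr)
          assume "\<not> i \<le> j"
          then have "blk ns j + ns ! j \<le> blk ns i" using blk_mono[of "Suc j" i ns] by (simp add: blk_Suc)
          then show False using pq(3) i j by simp
        qed
        moreover have "a \<le> b" if "i = j" using that pq(3) i j by simp
        ultimately show ?thesis using that by (cases "i = j"; cases "a = b"; cases "a = 0") auto
      qed
      then show ?thesis
      proof cases
        case 1
        then have "(p, q) \<in> idxI ns" unfolding i(3) j(3) using idxI_blk_iff[OF i(1,2) j(1,2)] by blast
        then show ?thesis using off[OF i(1,2) j(1,2) 1] R unfolding i(3) j(3) by blast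
      next
        case 2
        then show ?thesis using row0[of i b] R'(1) i j by simp
      next
        case 3
        then show ?thesis using diag[of i a] R'(2) i j by simp
      next
        case 4
        then show ?thesis using tr_E[OF i(1) R'(2)] R'(3) i j by simp
      qed
    qed
    show ?L using upper E_sym by (metis linear)
  qed
  then show ?thesis unfolding eq Let_def using d by simp
qed

section \<open>The mapping\<close>

definition lift_dual :: "real vec list \<Rightarrow> real mat" where
  "lift_dual s = diag_block_mat (map cone_lift s)"

text \<open>The dual component of \<open>map_M_inv\<close>.\<close>

definition trace_rows :: "nat list \<Rightarrow> real mat \<Rightarrow> real vec list" where
  "trace_rows ns S = map (\<lambda>i. vec (ns ! i)
     (\<lambda>j. if j = 0 then \<Sum>p\<in>{blk ns i..<blk ns i + ns ! i}. S $$ (p, p)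
          else 2 * S $$ (blk ns i, blk ns i + j))) [0..<length ns]"

lemma map_M_inv_eq: "map_M_inv ns (X, y, v, z, S) = (first_cols ns X, y, trace_rows ns S)"
  by (simp add: map_M_inv_def first_cols_def trace_rows_def)

lemma sum_block_interval:
  "(\<Sum>p\<in>{u..<u + n}. f p) = (\<Sum>a<n. f (u + a))" for u n :: nat
  using sum.shift_bounds_nat_ivl[of f 0 u n] by (simp add: lessThan_atLeast0 add.commute)

text \<open>Provides the nonemptiness of \<open>map_S\<close> on cone vectors, without which
  admissibility of the point-to-set map could hold vacuously.\<close>

lemma lift_dual_in_map_S:
  assumes pos: "\<forall>i<length ns. ns ! i \<ge> 1"
    and s: "length s = length ns" "\<forall>i<length ns. s ! i \<in> lorentz_cone (ns ! i)"
  shows "lift_dual s \<in> map_S ns s"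
proof -
  have psd: "psd_mat (ns ! i) (map cone_lift s ! i)" if "i < length ns" for i
    using psd_cone_lift[of "s ! i" "ns ! i"] that s pos by simp
  have car: "\<forall>i<length ns. map cone_lift s ! i \<in> carrier_mat (ns ! i) (ns ! i)"
    using psd unfolding psd_mat_iff by blast
  have svec: "s ! i \<in> carrier_vec (ns ! i)" if "i < length ns" for i
    using that s(2) unfolding lorentz_cone_def by blast
  have len: "length (map cone_lift s) = length ns" using s(1) by simp
  have idx: "lift_dual s $$ (blk ns i + a, blk ns i + b) = cone_lift (s ! i) $$ (a, b)"
    if "i < length ns" "a < ns ! i" "b < ns ! i" for i a b
    unfolding lift_dual_def using index_diag_block_mat[OF len car that(1,2) that(1,3)] that(1) s(1) by simp
  have "psd_mat (sum_list ns) (lift_dual s)"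
    unfolding lift_dual_def using psd by (intro psd_diag_block_mat len) blast
  moreover have "\<exists>Ss. length Ss = length ns \<and> (\<forall>i<length ns. sym_mat (ns ! i) (Ss ! i)) \<and> lift_dual s = diag_block_mat Ss"
    using psd len unfolding psd_mat_def lift_dual_def by blast
  moreover have "(\<Sum>j\<in>{blk ns i..<blk ns i + ns ! i}. lift_dual s $$ (j, j)) = s ! i $ 0"
    if i: "i < length ns" for i
    using trace_cone_lift[OF svec[OF i]] pos i by (simp add: sum_block_interval idx)
  moreover have "lift_dual s $$ (blk ns i, blk ns i + j) = s ! i $ j / 2"
    if i: "i < length ns" and j: "j \<in> {1..<ns ! i}" for i j
    using idx[OF i, of 0 j] cone_lift_first_row[OF svec[OF i], of j] j by simp
  ultimately show ?thesis unfolding map_S_def by blast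
qed

text \<open>The trace and first row conditions in \<open>map_S\<close> prescribe what
  \<open>trace_rows\<close> reads off, so every choice of \<open>S\<close> leads back to
  \<open>s\<close>.\<close>

lemma trace_rows_map_S:
  assumes s: "length s = length ns" "\<forall>i<length ns. s ! i \<in> carrier_vec (ns ! i)"
    and S: "S \<in> map_S ns s"
  shows "trace_rows ns S = s"
proof (rule nth_equalityI)
  fix i assume "i < length (trace_rows ns S)"
  then have i: "i < length ns" by (simp add: trace_rows_def)
  show "trace_rows ns S ! i = s ! i"
  proof (rule eq_vecI)
    have dim: "dim_vec (s ! i) = ns ! i" using i s(2) by (metis carrier_vecD)
    show "dim_vec (trace_rows ns S ! i) = dim_vec (s ! i)" using i by (simp add: trace_rows_def dim)
    fix j assume "j < dim_vec (s ! i)"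
    then have j: "j < ns ! i" by (simp add: dim)
    have "(\<Sum>j\<in>{blk ns i..<blk ns i + ns ! i}. S $$ (j, j)) = s ! i $ 0"
      and "0 < j \<Longrightarrow> S $$ (blk ns i, blk ns i + j) = s ! i $ j / 2"
      using S i j unfolding map_S_def by auto
    then show "trace_rows ns S ! i $ j = s ! i $ j"
      using i j by (cases "j = 0") (simp_all add: trace_rows_def)
  qed
qed (simp add: trace_rows_def s(1))

text \<open>Only the diagonal blocks of \<open>S\<close> enter, as principal submatrices. A dual
  feasible \<open>S\<close> may well have nonzero entries outside them.\<close>

lemma trace_rows_lorentz:
  assumes pos: "\<forall>i<length ns. ns ! i \<ge> 1" and S: "psd_mat (sum_list ns) S" and i: "i < length ns"
  shows "trace_rows ns S ! i \<in> lorentz_cone (ns ! i)"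
proof -
  have n: "1 \<le> ns ! i" using pos i by blast
  let ?B = "mat (ns ! i) (ns ! i) (\<lambda>(a, b). S $$ (blk ns i + a, blk ns i + b))"
  have "trace_rows ns S ! i = vec (ns ! i) (\<lambda>j. if j = 0 then \<Sum>p<ns ! i. ?B $$ (p, p) else 2 * ?B $$ (0, j))"
    using i n by (intro eq_vecI) (simp_all add: trace_rows_def sum_block_interval)
  then show ?thesis using psd_trace_row_in_lorentz_cone[OF psd_diag_block[OF S i] n] by simp
qed

text \<open>The parts of \<open>sdo_dual_eq_iff\<close> that are free of \<open>v\<close> and
  \<open>z\<close> are the coordinates of the SOCO dual equation.\<close>

lemma sdo_dual_eq_imp_soco:
  assumes pos: "\<forall>i<length ns. ns ! i \<ge> 1"
    and A: "length A = length ns" "\<forall>i<length ns. A ! i \<in> carrier_mat m (ns ! i)"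
    and c: "length c = length ns" "\<forall>i<length ns. c ! i \<in> carrier_vec (ns ! i)"
    and y: "y \<in> carrier_vec m" and S: "sym_mat (sum_list ns) S"
    and eq: "sdo_dual_eq ns m A c y v z S" and i: "i < length ns"
  shows "transpose_mat (A ! i) *\<^sub>v y + trace_rows ns S ! i = c ! i"
proof (rule eq_vecI)
  have dim: "dim_vec (c ! i) = ns ! i" using i c(2) by (metis carrier_vecD)
  have dimt: "dim_vec (trace_rows ns S ! i) = ns ! i" using i by (simp add: trace_rows_def)
  then show "dim_vec (transpose_mat (A ! i) *\<^sub>v y + trace_rows ns S ! i) = dim_vec (c ! i)" by (simp add: dim)
  fix j assume "j < dim_vec (c ! i)"
  then have j: "j < ns ! i" by (simp add: dim)
  have R: "\<forall>a\<in>{1..<ns ! i}. (transpose_mat (A ! i) *\<^sub>v y) $ a + 2 * S $$ (blk ns i, blk ns i + a) = c ! i $ a"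
    "(transpose_mat (A ! i) *\<^sub>v y) $ 0 + (\<Sum>a<ns ! i. S $$ (blk ns i + a, blk ns i + a)) = c ! i $ 0"
    using eq i unfolding sdo_dual_eq_iff[OF pos A c y S] Let_def by blast+
  have "(transpose_mat (A ! i) *\<^sub>v y) $ j + trace_rows ns S ! i $ j = c ! i $ j"
    \<comment> \<open>The coordinates of the matrix-vector product stay folded so that they match
      \<open>R\<close>.\<close>
    using R i j by (cases "j = 0") (simp_all add: trace_rows_def sum_block_interval del: index_mult_mat_vec)
  then show "(transpose_mat (A ! i) *\<^sub>v y + trace_rows ns S ! i) $ j = c ! i $ j"
    using j by (simp add: dimt del: index_mult_mat_vec)
qed

text \<open>The row and trace equations in \<open>sdo_dual_eq_iff\<close> follow from the SOCO dual
  equation and \<open>map_S\<close>. What is left prescribes \<open>v\<close> and \<open>z\<close>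
  on their index sets, and extensionality fixes them outside.\<close>

lemma ex1_dual_multipliers:
  assumes pos: "\<forall>i<length ns. ns ! i \<ge> 1"
    and A: "length A = length ns" "\<forall>i<length ns. A ! i \<in> carrier_mat m (ns ! i)"
    and c: "length c = length ns" "\<forall>i<length ns. c ! i \<in> carrier_vec (ns ! i)"
    and ys: "(y, s) \<in> soco_dual_feasible ns m A c" and S: "S \<in> map_S ns s"
  shows "\<exists>!(v, z). v \<in> idxI ns \<rightarrow>\<^sub>E UNIV \<and> z \<in> idxK ns \<rightarrow>\<^sub>E UNIV \<and> sdo_dual_eq ns m A c y v z S"
proof -
  have y: "y \<in> carrier_vec m" and s: "length s = length ns"
    and dual: "\<And>i. i < length ns \<Longrightarrow> transpose_mat (A ! i) *\<^sub>v y + s ! i = c ! i"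
    and svec: "\<And>i. i < length ns \<Longrightarrow> s ! i \<in> carrier_vec (ns ! i)"
    using ys by (auto simp: soco_dual_feasible_def lorentz_cone_def)
  have sym: "sym_mat (sum_list ns) S" using S by (simp add: map_S_def psd_mat_def)
  have row: "(transpose_mat (A ! i) *\<^sub>v y) $ a + s ! i $ a = c ! i $ a" if "i < length ns" "a < ns ! i" for i a
    using dual[OF that(1)] svec[OF that(1)] that(2)
    by (metis carrier_vecD index_add_vec(1))
  \<comment> \<open>The value forced on \<open>z\<close>, as a function of the row number instead of
    block and offset.\<close>
  define w where "w h = (let i = Cf ns h in
    ((transpose_mat (A ! i) *\<^sub>v y) $ 0 - c ! i $ 0) / ns ! i + S $$ (h, h))" for h
  have row0: "(transpose_mat (A ! i) *\<^sub>v y) $ a + 2 * S $$ (blk ns i, blk ns i + a) = c ! i $ a"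
    if "i < length ns" "a \<in> {1..<ns ! i}" for i a
  proof -
    have "S $$ (blk ns i, blk ns i + a) = s ! i $ a / 2" using S that unfolding map_S_def by blast
    then show ?thesis using row[OF that(1), of a] that(2) by (simp del: index_mult_mat_vec)
  qed
  have tr: "(transpose_mat (A ! i) *\<^sub>v y) $ 0 + (\<Sum>a<ns ! i. S $$ (blk ns i + a, blk ns i + a)) = c ! i $ 0"
    if "i < length ns" for i
  proof -
    have "(\<Sum>a<ns ! i. S $$ (blk ns i + a, blk ns i + a)) = s ! i $ 0"
      using S that unfolding map_S_def sum_block_interval by blast
    then show ?thesis using row[OF that, of 0] pos that by (simp add: Suc_le_eq del: index_mult_mat_vec)
  qed
  have K: "(\<forall>i<length ns. \<forall>a\<in>{1..<ns ! i}. z (blk ns i + a) =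
      ((transpose_mat (A ! i) *\<^sub>v y) $ 0 - c ! i $ 0) / ns ! i + S $$ (blk ns i + a, blk ns i + a))
    \<longleftrightarrow> (\<forall>k\<in>idxK ns. z k = w k)" (is "?L \<longleftrightarrow> ?R") for z
  proof
    assume L: ?L
    show ?R
    proof
      fix k assume k: "k \<in> idxK ns"
      then have "k < sum_list ns" by (simp add: idxK_def)
      then obtain i a where i: "i < length ns" "a < ns ! i" "k = blk ns i + a"
        by (rule block_index_obtain)
      then have "0 < a" using k idxK_blk_iff by blast
      then show "z k = w k" using L i by (simp add: w_def Cf_blk_add del: index_mult_mat_vec)
    qed
  next
    assume R: ?R
    show ?L
    proof (intro allI impI ballI)
      fix i a assume i: "i < length ns" and a: "a \<in> {1..<ns ! i}"
      then have "blk ns i + a \<in> idxK ns" by (simp add: idxK_blk_iff)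
      then show "z (blk ns i + a) =
        ((transpose_mat (A ! i) *\<^sub>v y) $ 0 - c ! i $ 0) / ns ! i + S $$ (blk ns i + a, blk ns i + a)"
        using R i a by (simp add: w_def Cf_blk_add del: index_mult_mat_vec)
    qed
  qed
  have iff: "sdo_dual_eq ns m A c y v z S \<longleftrightarrow>
      (\<forall>hl\<in>idxI ns. v hl = - S $$ hl) \<and> (\<forall>k\<in>idxK ns. z k = w k)" for v z
  proof -
    have pair: "(\<forall>(h, l)\<in>idxI ns. v (h, l) = - S $$ (h, l)) \<longleftrightarrow> (\<forall>hl\<in>idxI ns. v hl = - S $$ hl)"
      by auto
    show ?thesis
      unfolding sdo_dual_eq_iff[OF pos A c y sym] Let_def K[symmetric] pair using row0 tr by blast
  qed
  show ?thesis
  proof (rule ex1I[of _ "(restrict (\<lambda>hl. - S $$ hl) (idxI ns), restrict w (idxK ns))"])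
    show "case (restrict (\<lambda>hl. - S $$ hl) (idxI ns), restrict w (idxK ns)) of (v, z) \<Rightarrow>
      v \<in> idxI ns \<rightarrow>\<^sub>E UNIV \<and> z \<in> idxK ns \<rightarrow>\<^sub>E UNIV \<and> sdo_dual_eq ns m A c y v z S"
      by (simp add: iff)
  next
    fix vz assume vz: "case vz of (v, z) \<Rightarrow>
      v \<in> idxI ns \<rightarrow>\<^sub>E UNIV \<and> z \<in> idxK ns \<rightarrow>\<^sub>E UNIV \<and> sdo_dual_eq ns m A c y v z S"
    obtain v z where eq: "vz = (v, z)" by (cases vz)
    have v: "v \<in> extensional (idxI ns)" "\<And>hl. hl \<in> idxI ns \<Longrightarrow> v hl = - S $$ hl"
      and z: "z \<in> extensional (idxK ns)" "\<And>k. k \<in> idxK ns \<Longrightarrow> z k = w k"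
      using vz unfolding eq prod.case iff PiE_def by blast+
    have "v = restrict (\<lambda>hl. - S $$ hl) (idxI ns)"
      by (rule extensionalityI[OF v(1) restrict_extensional]) (simp add: v(2))
    moreover have "z = restrict w (idxK ns)"
      by (rule extensionalityI[OF z(1) restrict_extensional]) (simp add: z(2))
    ultimately show "vz = (restrict (\<lambda>hl. - S $$ hl) (idxI ns), restrict w (idxK ns))"
      unfolding eq by (rule arg_cong2)
  qed
qed

text \<open>Besides admissibility, the conclusion states that images are not empty, that
  \<open>v\<close> and \<open>z\<close> are the values determined by \<open>S\<close>, and that the
  inverse mapping undoes each choice made by the point-to-set map.\<close>

theorem theorem4p6:
  fixes ns :: "nat list" and m :: nat
    and A :: "real mat list" and b :: "real vec" and c :: "real vec list"
  assumes "length ns \<ge> 1" and "\<forall>i<length ns. ns ! i \<ge> 1"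
    and "length A = length ns" and "\<forall>i<length ns. A ! i \<in> carrier_mat m (ns ! i)"
    and "length c = length ns" and "\<forall>i<length ns. c ! i \<in> carrier_vec (ns ! i)"
    and "b \<in> carrier_vec m"
  shows "admissible_mapping ns m A b c (map_M ns m A c) (map_M_inv ns)
    \<and> (\<forall>(x, y, s) \<in> soco_primal_feasible ns m A b \<times> soco_dual_feasible ns m A c.
           map_S ns s \<noteq> {} \<and>
           (\<forall>S \<in> map_S ns s. \<exists>!(v, z). v \<in> idxI ns \<rightarrow>\<^sub>E UNIV \<and> z \<in> idxK ns \<rightarrow>\<^sub>E UNIV
                                     \<and> sdo_dual_eq ns m A c y v z S))
    \<and> (\<forall>p \<in> soco_primal_feasible ns m A b \<times> soco_dual_feasible ns m A c.
           \<forall>q \<in> map_M ns m A c p. map_M_inv ns q = p)"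
proof -
  note pos = assms(2) and A = assms(3,4) and c = assms(5,6)
  let ?same_obj = "\<lambda>(x, y, s) (X, y', v, z, S).
    soco_primal_obj c x = sdo_primal_obj c X \<and> b \<bullet> y = b \<bullet> y'"
  note image = sdo_primal_feasible_eq_image[OF pos A assms(7)]
  have x: "length x = length ns" "\<forall>i<length ns. x ! i \<in> carrier_vec (ns ! i)"
    if "x \<in> soco_primal_feasible ns m A b" for x
    using that by (auto simp: soco_primal_feasible_def lorentz_cone_def)
  have s: "length s = length ns" "\<forall>i<length ns. s ! i \<in> lorentz_cone (ns ! i)"
    "\<forall>i<length ns. s ! i \<in> carrier_vec (ns ! i)"
    if "(y, s) \<in> soco_dual_feasible ns m A c" for y s
    using that by (auto simp: soco_dual_feasible_def lorentz_cone_def)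
  have obj: "soco_primal_obj c x = sdo_primal_obj c (DArw x)" if "x \<in> soco_primal_feasible ns m A b" for x
    by (simp add: soco_primal_obj_def sdo_primal_obj_def sdo_C_def c(1)
        trace_sdo_data_mat_DArw[OF pos c x[OF that]])
  have first: "first_cols ns (DArw x) = x" if "x \<in> soco_primal_feasible ns m A b" for x
    by (rule first_cols_DArw[OF pos x[OF that]])
  have inv: "map_M_inv ns q = p"
    if "p \<in> soco_primal_feasible ns m A b \<times> soco_dual_feasible ns m A c" "q \<in> map_M ns m A c p" for p q
  proof -
    obtain x y s where p: "p = (x, y, s)" by (cases p) auto
    obtain X y' v z S where q: "q = (X, y', v, z, S)" by (cases q) auto
    have "x \<in> soco_primal_feasible ns m A b" "(y, s) \<in> soco_dual_feasible ns m A c"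
      "X = DArw x" "y' = y" "S \<in> map_S ns s"
      using that by (auto simp: p q map_M_def)
    then show ?thesis
      by (simp add: p q map_M_inv_eq first trace_rows_map_S[OF s(1,3)])
  qed
  \<comment> \<open>The dual equation and positive semidefiniteness are part of \<open>map_M\<close>
    and \<open>map_S\<close>; the primal side is \<open>image\<close>.\<close>
  have fwd: "map_M ns m A c p \<subseteq> sdo_primal_feasible ns m A b \<times> sdo_dual_feasible ns m A c"
    if "p \<in> soco_primal_feasible ns m A b \<times> soco_dual_feasible ns m A c" for p
    using that by (auto simp: map_M_def image sdo_dual_feasible_def soco_dual_feasible_def map_S_def)
  have bwd: "map_M_inv ns q \<in> soco_primal_feasible ns m A b \<times> soco_dual_feasible ns m A c
      \<and> ?same_obj (map_M_inv ns q) q"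
    if qG: "q \<in> sdo_primal_feasible ns m A b \<times> sdo_dual_feasible ns m A c" for q
  proof -
    obtain X y v z S where q: "q = (X, y, v, z, S)" by (cases q) auto
    \<comment> \<open>By \<open>image\<close> every feasible \<open>X\<close> is
      \<open>DArw x\<close> with \<open>x\<close> feasible, so \<open>first\<close> and
      \<open>obj\<close> give the primal component of the inverse and its objective value.\<close>
    obtain x where X: "x \<in> soco_primal_feasible ns m A b" "X = DArw x"
      using qG by (auto simp: q image)
    have D: "y \<in> carrier_vec m" "sdo_dual_eq ns m A c y v z S" "psd_mat (sum_list ns) S"
      using qG by (auto simp: q sdo_dual_feasible_def)
    then have "sym_mat (sum_list ns) S" by (simp add: psd_mat_def)
    then have "(y, trace_rows ns S) \<in> soco_dual_feasible ns m A c"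
      using D sdo_dual_eq_imp_soco[OF pos A c D(1) _ D(2)] trace_rows_lorentz[OF pos D(3)]
      by (simp add: soco_dual_feasible_def trace_rows_def)
    then show ?thesis using X by (simp add: q map_M_inv_eq first obj)
  qed
  have fwd_obj: "?same_obj p q"
    if "p \<in> soco_primal_feasible ns m A b \<times> soco_dual_feasible ns m A c" "q \<in> map_M ns m A c p" for p q
    using that by (auto simp: map_M_def obj)
  have "admissible_mapping ns m A b c (map_M ns m A c) (map_M_inv ns)"
    unfolding admissible_mapping_def Let_def
    by (intro conjI ballI fwd fwd_obj bwd[THEN conjunct1] bwd[THEN conjunct2])
  moreover have "\<forall>(x, y, s) \<in> soco_primal_feasible ns m A b \<times> soco_dual_feasible ns m A c.
      map_S ns s \<noteq> {} \<and>
      (\<forall>S \<in> map_S ns s. \<exists>!(v, z). v \<in> idxI ns \<rightarrow>\<^sub>E UNIV \<and> z \<in> idxK ns \<rightarrow>\<^sub>E UNIV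
        \<and> sdo_dual_eq ns m A c y v z S)"
  proof (intro ballI, clarify, intro conjI ballI)
    fix x y s assume ys: "(y, s) \<in> soco_dual_feasible ns m A c"
    show "map_S ns s \<noteq> {}"
      using lift_dual_in_map_S[OF pos s(1,2)[OF ys]] by blast
    fix S assume "S \<in> map_S ns s"
    then show "\<exists>!(v, z). v \<in> idxI ns \<rightarrow>\<^sub>E UNIV \<and> z \<in> idxK ns \<rightarrow>\<^sub>E UNIV \<and> sdo_dual_eq ns m A c y v z S"
      by (rule ex1_dual_multipliers[OF pos A c ys])
  qed
  moreover have "\<forall>p \<in> soco_primal_feasible ns m A b \<times> soco_dual_feasible ns m A c.
      \<forall>q \<in> map_M ns m A c p. map_M_inv ns q = p"
    by (intro ballI inv)
  ultimately show ?thesis by (intro conjI)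
qed

end
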